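(* Let $X$ be a finite alphabet with at least two letters and $k\ge2$, and let $\mathcal{B}$ be either the class $\mathcal R$ of regular $\omega$-languages or the class $\mathcal A$ of aperiodic $\omega$-languages over $X$. Then for every $F\in\mathcal{F}_{\mathcal{T}_k}$ we have $\mathcal{B}\mathbf{\Sigma}(F)=\mathcal{B}_k\cap\mathbf{\Sigma}(F)$.
   Context: Regular and aperiodic $\omega$-languages: recognised by deterministic Muller acceptors (resp. with aperiodic automaton, i.e. $f(q,u^n)=q$, $u\neq\varepsilon$, $n>0$ imply $f(q,u)=q$). $\bar k=\{0,\dots,k-1\}$; $\mathcal B_k$ is the set of functions $X^\omega\to\bar k$ all of whose preimages $A^{-1}(i)$ lie in $\mathcal B$. Trees/forests: a finite nonempty poset whose lower cones are chains is a forest; a tree has a least element. We represent a forest as a finite set $F\subseteq\omega^+$ of nonempty finite strings closed under nonempty prefixes, ordered by the prefix relation (roots are strings of length 1, successors of $\tau$ are the $\tau i\in F$), and a tree as a finite $V\subseteq\omega^*$ closed under prefixes (root $\varepsilon$). $\mathcal T_k$ is the set of trees labeled by $\bar k$; $\mathcal F_{\mathcal T_k}$ the set of forests $(F,c)$ with each label $c(\tau)=(V,v)\in\mathcal T_k$. A 2-base in a set $S$ is a pair $\mathcal L=(\mathcal L_0,\mathcal L_1)$ of families of subsets of $S$ closed under finite unions and intersections and containing $\emptyset,S$, with each set of $\mathcal L_0$ and its complement in $\mathcal L_1$. For a 1-base $\mathcal L'$ in a set $S'$ and a forest (or tree) $W$ labeled in $\bar k$ or $\mathcal T_k$, a $W$-family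 over $\mathcal L'$ is $\{U_\tau\}_{\tau\in W}$ with $U_\tau\in\mathcal L'$, $U_{\tau i}\subseteq U_\tau$, $\bigcup_\tau U_\tau=S'$; write $\tilde U_\tau=U_\tau\setminus\bigcup_{\tau i\in W}U_{\tau i}$. For $(F,c)\in\mathcal F_{\mathcal T_k}$, an $F$-family over $\mathcal L$ consists of an $F$-family $\{U_\tau\}$ over $\mathcal L_0$ and, for each $\tau\in F$ with $c(\tau)=(V,v)$, a $V$-family $\{U_{\tau\sigma}\}_{\sigma\in V}$ over the 1-base $\{\tilde U_\tau\cap B: B\in\mathcal L_1\}$ in $\tilde U_\tau$; it determines $A:S\to\bar k$ if $A(x)=v(\sigma)$ whenever $\tau\in F$, $c(\tau)=(V,v)$, $\sigma\in V$ and $x\in\tilde U_{\tau\sigma}=U_{\tau\sigma}\setminus\bigcup_{\sigma i\in V}U_{\tau\sigma i}$. $\mathcal L(F)$ is the set of $k$-partitions of $S$ determined by some $F$-family over $\mathcal L$. $\mathbf\Sigma=(\mathbf\Sigma^0_1,\mathbf\Sigma^0_2)$ is the 2-base in $X^\omega$ of open sets and countable unions of closed sets (Cantor topology); $\mathbf\Sigma(F)$ is its level. $\mathcal B\mathbf\Sigma$ is the 2-base $(\mathcal B\cap\mathbf\Sigma^0_1,\mathcal B\cap\mathbf\Sigma^0_2)$ and $\mathcal B\mathbf\Sigma(F)$ its level. *)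

theory Defs
  imports Main
begin

type_synonym 'a oword = "nat \<Rightarrow> 'a"

definition is_muller :: "nat set \<Rightarrow> nat \<Rightarrow> (nat \<Rightarrow> 'a \<Rightarrow> nat) \<Rightarrow> nat set set \<Rightarrow> bool" where
  "is_muller Q q0 \<delta> T \<longleftrightarrow> finite Q \<and> q0 \<in> Q \<and> (\<forall>q\<in>Q. \<forall>a. \<delta> q a \<in> Q) \<and> T \<subseteq> Pow Q"

primrec run :: "(nat \<Rightarrow> 'a \<Rightarrow> nat) \<Rightarrow> nat \<Rightarrow> 'a oword \<Rightarrow> nat \<Rightarrow> nat" where
  "run \<delta> q0 x 0 = q0"
| "run \<delta> q0 x (Suc n) = \<delta> (run \<delta> q0 x n) (x n)"

definition muller_lang :: "nat \<Rightarrow> (nat \<Rightarrow> 'a \<Rightarrow> nat) \<Rightarrow> nat set set \<Rightarrow> 'a oword set" where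
  "muller_lang q0 \<delta> T = {x. {q. \<exists>\<^sub>\<infinity>n. run \<delta> q0 x n = q} \<in> T}"

definition ext_delta :: "(nat \<Rightarrow> 'a \<Rightarrow> nat) \<Rightarrow> nat \<Rightarrow> 'a list \<Rightarrow> nat" where
  "ext_delta \<delta> q u = foldl \<delta> q u"

definition aperiodic_aut :: "nat set \<Rightarrow> (nat \<Rightarrow> 'a \<Rightarrow> nat) \<Rightarrow> bool" where
  "aperiodic_aut Q \<delta> \<longleftrightarrow> (\<forall>q\<in>Q. \<forall>u n. u \<noteq> [] \<and> n > 0 \<and>
       ext_delta \<delta> q (concat (replicate n u)) = q \<longrightarrow> ext_delta \<delta> q u = q)"

definition regular_langs :: "'a oword set set" where
  "regular_langs = {L. \<exists>Q q0 \<delta> T. is_muller Q q0 \<delta> T \<and> L = muller_lang q0 \<delta> T}"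

definition aperiodic_langs :: "'a oword set set" where
  "aperiodic_langs = {L. \<exists>Q q0 \<delta> T. is_muller Q q0 \<delta> T \<and> aperiodic_aut Q \<delta> \<and> L = muller_lang q0 \<delta> T}"

definition cantor_open :: "'a oword set \<Rightarrow> bool" where
  "cantor_open L \<longleftrightarrow> (\<forall>x\<in>L. \<exists>n. \<forall>y. (\<forall>i<n. y i = x i) \<longrightarrow> y \<in> L)"

definition cantor_closed :: "'a oword set \<Rightarrow> bool" where
  "cantor_closed L \<longleftrightarrow> cantor_open (- L)"

definition Sigma01 :: "'a oword set set" where
  "Sigma01 = {L. cantor_open L}"

definition Sigma02 :: "'a oword set set" where
  "Sigma02 = {L. \<exists>C :: nat \<Rightarrow> 'a oword set. (\<forall>n. cantor_closed (C n)) \<and> L = (\<Union>n. C n)}"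

definition Bk :: "nat \<Rightarrow> 'b set set \<Rightarrow> ('b \<Rightarrow> nat) set" where
  "Bk k \<B> = {A. (\<forall>x. A x < k) \<and> (\<forall>i<k. A -` {i} \<in> \<B>)}"

definition is_ktree :: "nat \<Rightarrow> nat list set \<times> (nat list \<Rightarrow> nat) \<Rightarrow> bool" where
  "is_ktree k Vv \<longleftrightarrow> (let V = fst Vv; v = snd Vv in
     finite V \<and> [] \<in> V \<and> (\<forall>\<sigma> \<tau>. \<sigma> @ \<tau> \<in> V \<longrightarrow> \<sigma> \<in> V) \<and> (\<forall>\<sigma>\<in>V. v \<sigma> < k))"

definition is_forest :: "nat list set \<Rightarrow> bool" where
  "is_forest F \<longleftrightarrow> finite F \<and> F \<noteq> {} \<and> [] \<notin> F \<and>
     (\<forall>\<sigma> \<tau>. \<sigma> \<noteq> [] \<longrightarrow> \<sigma> @ \<tau> \<in> F \<longrightarrow> \<sigma> \<in> F)"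

definition is_Tk_forest :: "nat \<Rightarrow> nat list set \<Rightarrow> (nat list \<Rightarrow> nat list set \<times> (nat list \<Rightarrow> nat)) \<Rightarrow> bool" where
  "is_Tk_forest k F c \<longleftrightarrow> is_forest F \<and> (\<forall>\<tau>\<in>F. is_ktree k (c \<tau>))"

definition is_family :: "nat list set \<Rightarrow> 'b set set \<Rightarrow> 'b set \<Rightarrow> (nat list \<Rightarrow> 'b set) \<Rightarrow> bool" where
  "is_family W L' S' U \<longleftrightarrow> (\<forall>\<tau>\<in>W. U \<tau> \<in> L') \<and>
     (\<forall>\<tau> i. \<tau> \<in> W \<longrightarrow> \<tau> @ [i] \<in> W \<longrightarrow> U (\<tau> @ [i]) \<subseteq> U \<tau>) \<and>
     (\<Union>\<tau>\<in>W. U \<tau>) = S'"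

definition tilde :: "nat list set \<Rightarrow> (nat list \<Rightarrow> 'b set) \<Rightarrow> nat list \<Rightarrow> 'b set" where
  "tilde W U \<tau> = U \<tau> - (\<Union>i\<in>{i. \<tau> @ [i] \<in> W}. U (\<tau> @ [i]))"

definition is_F_family :: "'b set set \<Rightarrow> 'b set set \<Rightarrow> nat list set \<Rightarrow> (nat list \<Rightarrow> nat list set \<times> (nat list \<Rightarrow> nat))
    \<Rightarrow> (nat list \<Rightarrow> 'b set) \<Rightarrow> (nat list \<Rightarrow> nat list \<Rightarrow> 'b set) \<Rightarrow> bool" where
  "is_F_family L0 L1 F c U U2 \<longleftrightarrow> is_family F L0 UNIV U \<and>
     (\<forall>\<tau>\<in>F. is_family (fst (c \<tau>)) {tilde F U \<tau> \<inter> B | B. B \<in> L1} (tilde F U \<tau>) (U2 \<tau>))"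

definition determines :: "nat list set \<Rightarrow> (nat list \<Rightarrow> nat list set \<times> (nat list \<Rightarrow> nat))
    \<Rightarrow> (nat list \<Rightarrow> nat list \<Rightarrow> 'b set) \<Rightarrow> ('b \<Rightarrow> nat) \<Rightarrow> bool" where
  "determines F c U2 A \<longleftrightarrow> (\<forall>\<tau>\<in>F. \<forall>\<sigma>\<in>fst (c \<tau>). \<forall>x\<in>tilde (fst (c \<tau>)) (U2 \<tau>) \<sigma>. A x = snd (c \<tau>) \<sigma>)"

definition level :: "nat \<Rightarrow> 'b set set \<Rightarrow> 'b set set \<Rightarrow> nat list set \<Rightarrow> (nat list \<Rightarrow> nat list set \<times> (nat list \<Rightarrow> nat))
    \<Rightarrow> ('b \<Rightarrow> nat) set" where
  "level k L0 L1 F c = {A. (\<forall>x. A x < k) \<and> (\<exists>U U2. is_F_family L0 L1 F c U U2 \<and> determines F c U2 A)}"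

end

theory Submission
  imports Defs "HOL-Library.Sublist" "HOL-Library.Countable" "HOL-Library.Infinite_Set"
begin

text \<open>
  Let one Muller automaton with initial state \<open>s0\<close> separate all the preimages of \<open>A\<close>, so that
  \<open>A = A\<^bsub>s0\<^esub>\<close> where \<open>A\<^bsub>q\<^esub> x\<close> depends only on the infinity set of the run from \<open>q\<close> on \<open>x\<close>. While
  reading the input, move up in the forest to a maximal node \<open>\<tau>\<close> such that \<open>A\<^bsub>q\<^esub>\<close> lies in the level
  of the subtree at \<open>\<tau>\<close>. Any open family witnessing this for \<open>q\<close> puts every word whose run stays
  in states with maximal node \<open>\<tau>\<close> into the component of \<open>\<tau>\<close>, for otherwise a prefix of the word
  would lead to a state admitting a higher node. This settles the first level.

  On the second level, let \<open>E\<close> be a strongly connected set of states. The words whose run stays in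
  \<open>E\<close> form a closed set in which those with infinity set \<open>E\<close> are comeager, so by Baire category a
  node of the tree with the label of \<open>E\<close> is available on a cylinder, and hence from every state of
  \<open>E\<close>. Infinity sets shrink through different supersets, so the choice of the node for \<open>E\<close>
  depends on the order in which the other states have been visited for the last time. This order
  is a stable prefix of the latest appearance record, and adjoining such a record keeps an
  automaton aperiodic: words act on records by idempotents.
\<close>

subsection \<open>Runs and shifts of infinite words\<close>

text \<open>The prefix is given by an infinite word and a length, so every word is
  \<open>conc\<close> of itself and its own shift.\<close>

definition conc :: "nat \<Rightarrow> 'a oword \<Rightarrow> 'a oword \<Rightarrow> 'a oword" where
  "conc m x y = (\<lambda>i. if i < m then x i else y (i - m))"

text \<open>States may have any type, since pairs and records serve as states below. Using
  \<open>foldl\<close> ties runs to the action of finite words in the condition of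
  aperiodicity.\<close>

definition srun :: "('s \<Rightarrow> 'a \<Rightarrow> 's) \<Rightarrow> 's \<Rightarrow> 'a oword \<Rightarrow> nat \<Rightarrow> 's" where
  "srun d q x n = foldl d q (map x [0..<n])"

lemma srun_simps [simp]:
  "srun d q x 0 = q"
  "srun d q x (Suc n) = d (srun d q x n) (x n)"
  by (simp_all add: srun_def)

lemma run_eq_srun: "run d q x n = srun d q x n"
  by (induction n) simp_all

lemma srun_cong: "(\<And>i. i < n \<Longrightarrow> x i = y i) \<Longrightarrow> srun d q x n = srun d q y n"
  by (induction n) auto

lemma conc_less [simp]: "i < m \<Longrightarrow> conc m x y i = x i"
  by (simp add: conc_def)

lemma conc_add [simp]: "conc m x y (m + i) = y i"
  by (simp add: conc_def)

lemma conc_shift [simp]: "conc m x (\<lambda>i. x (m + i)) = x"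
  by (auto simp: conc_def)

lemma srun_conc_add: "srun d q (conc m x y) (m + n) = srun d (srun d q x m) y n"
proof (induction n)
  case 0
  then show ?case by (auto intro: srun_cong)
qed simp

lemma srun_conc_le: "n \<le> m \<Longrightarrow> srun d q (conc m x y) n = srun d q x n"
  by (auto intro: srun_cong)

lemma srun_shift: "srun d q x (m + n) = srun d (srun d q x m) (\<lambda>i. x (m + i)) n"
  using srun_conc_add[of d q m x "\<lambda>i. x (m + i)" n] by simp

definition infs :: "('s \<Rightarrow> 'a \<Rightarrow> 's) \<Rightarrow> 's \<Rightarrow> 'a oword \<Rightarrow> 's set" where
  "infs d q x = {s. \<exists>\<^sub>\<infinity>n. srun d q x n = s}"

lemma infs_iff: "s \<in> infs d q x \<longleftrightarrow> (\<forall>n. \<exists>m\<ge>n. srun d q x m = s)"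
  by (simp add: infs_def INFM_nat_le)

lemma infs_shift: "infs d (srun d q x m) (\<lambda>i. x (m + i)) = infs d q x"
proof -
  have "(\<forall>n. \<exists>j\<ge>n. srun d q x (m + j) = s) \<longleftrightarrow> (\<forall>n. \<exists>j\<ge>n. srun d q x j = s)" for s
  proof safe
    fix n assume "\<forall>n. \<exists>j\<ge>n. srun d q x (m + j) = s"
    then obtain j where "j \<ge> n" "srun d q x (m + j) = s" by blast
    then show "\<exists>j\<ge>n. srun d q x j = s" by (intro exI[of _ "m + j"]) auto
  next
    fix n assume "\<forall>n. \<exists>j\<ge>n. srun d q x j = s"
    then obtain j where "j \<ge> m + n" "srun d q x j = s" by blast
    then show "\<exists>j\<ge>n. srun d q x (m + j) = s" by (intro exI[of _ "j - m"]) auto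
  qed
  then show ?thesis by (auto simp: infs_iff simp flip: srun_shift)
qed

lemma infs_conc: "infs d q (conc m x y) = infs d (srun d q x m) y"
  using infs_shift[of d q "conc m x y" m] by (simp add: srun_conc_le)

text \<open>By pigeonhole, a property violated again and again is violated infinitely often at one
  state of the finite set \<open>S\<close>. This turns eventual properties into Muller
  conditions.\<close>

lemma eventually_infs:
  assumes "finite S" "\<And>n. srun d q x n \<in> S"
  shows "(\<exists>n. \<forall>m\<ge>n. Q (srun d q x m)) \<longleftrightarrow> (\<forall>s\<in>infs d q x. Q s)"
proof
  assume "\<exists>n. \<forall>m\<ge>n. Q (srun d q x m)"
  then show "\<forall>s\<in>infs d q x. Q s" by (metis infs_iff)
next
  assume Q: "\<forall>s\<in>infs d q x. Q s"
  show "\<exists>n. \<forall>m\<ge>n. Q (srun d q x m)"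
  proof (rule ccontr)
    assume "\<not> ?thesis"
    then have "\<exists>\<^sub>\<infinity>n. \<exists>s\<in>S. srun d q x n = s \<and> \<not> Q s"
      using assms(2) by (auto simp: INFM_nat_le)
    then obtain s where "\<exists>\<^sub>\<infinity>n. srun d q x n = s \<and> \<not> Q s"
      using frequently_bex_finite[OF assms(1), of "\<lambda>n s. srun d q x n = s \<and> \<not> Q s"] by blast
    then have "s \<in> infs d q x" "\<not> Q s" by (auto simp: INFM_nat_le infs_iff; blast)+
    with Q show False by blast
  qed
qed

subsection \<open>Topology\<close>

lemma cantor_closedD: "cantor_closed C \<Longrightarrow> x \<notin> C \<Longrightarrow> \<exists>n. \<forall>y. (\<forall>i<n. y i = x i) \<longrightarrow> y \<notin> C"
  by (auto simp: cantor_closed_def cantor_open_def)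

lemma cantor_open_conc:
  assumes "cantor_open L"
  shows "cantor_open {y. conc m z y \<in> L}"
  unfolding cantor_open_def
proof safe
  fix x assume "conc m z x \<in> L"
  then obtain n where n: "\<And>y. (\<forall>i<n. y i = conc m z x i) \<Longrightarrow> y \<in> L"
    using assms unfolding cantor_open_def by blast
  show "\<exists>n. \<forall>y. (\<forall>i<n. y i = x i) \<longrightarrow> y \<in> {y. conc m z y \<in> L}"
    by (intro exI[of _ n]) (auto intro!: n simp: conc_def)
qed

lemma cantor_closed_conc:
  assumes "cantor_closed L"
  shows "cantor_closed {y. conc m z y \<in> L}"
  using cantor_open_conc[of "- L" m z] assms
  by (simp add: cantor_closed_def Collect_neg_eq)

lemma Sigma02_conc:
  assumes "L \<in> Sigma02"
  shows "{y. conc m z y \<in> L} \<in> Sigma02"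
proof -
  have "\<exists>C :: nat \<Rightarrow> 'a oword set. (\<forall>n. cantor_closed (C n)) \<and> L = (\<Union>n. C n)"
    using assms by (simp add: Sigma02_def)
  then obtain C :: "nat \<Rightarrow> 'a oword set" where C: "\<forall>n. cantor_closed (C n)" "L = (\<Union>n. C n)"
    by (elim exE conjE) (rule that)
  have "cantor_closed {y. conc m z y \<in> C n}" for n
    using C(1) by (simp add: cantor_closed_conc)
  moreover have "{y. conc m z y \<in> L} = (\<Union>n. {y. conc m z y \<in> C n})"
    by (auto simp: C(2))
  ultimately show ?thesis
    unfolding Sigma02_def by (intro CollectI exI[of _ "\<lambda>n. {y. conc m z y \<in> C n}"]) simp
qed

lemma Sigma02_UN_countable:
  fixes C :: "'i::countable \<Rightarrow> 'a oword set"
  assumes "\<And>i. cantor_closed (C i)"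
  shows "(\<Union>i. C i) \<in> Sigma02"
  unfolding Sigma02_def
proof (intro CollectI exI conjI allI)
  show "cantor_closed (C (from_nat n))" for n by (rule assms)
  have "(\<Union>i. C i) \<subseteq> (\<Union>n. C (from_nat n))"
  proof
    fix x assume "x \<in> (\<Union>i. C i)"
    then obtain i where "x \<in> C i" by blast
    then show "x \<in> (\<Union>n. C (from_nat n))" by (intro UN_I[of "to_nat i"]) auto
  qed
  then show "(\<Union>i. C i) = (\<Union>n. C (from_nat n))" by blast
qed

lemma cantor_closed_prefixes:
  assumes "\<And>x y n. (\<And>i. i < n \<Longrightarrow> x i = y i) \<Longrightarrow> P n x \<Longrightarrow> P n y"
  shows "cantor_closed {x. \<forall>n. P n x}"
  unfolding cantor_closed_def cantor_open_def
proof
  fix x assume "x \<in> - {x. \<forall>n. P n x}"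
  then obtain n where n: "\<not> P n x" by blast
  have "\<not> P n y" if "\<forall>i<n. y i = x i" for y
    using assms[of n y x] that n by blast
  then show "\<exists>n. \<forall>y. (\<forall>i<n. y i = x i) \<longrightarrow> y \<in> - {x. \<forall>n. P n x}"
    by blast
qed

lemma cantor_open_prefixes:
  assumes "\<And>x y n. (\<And>i. i < n \<Longrightarrow> x i = y i) \<Longrightarrow> P n x \<Longrightarrow> P n y"
  shows "cantor_open {x. \<exists>n. P n x}"
  unfolding cantor_open_def
proof safe
  fix x n assume n: "P n x"
  have "P n y" if "\<forall>i<n. y i = x i" for y
    using assms[of n x y] that n by simp
  then show "\<exists>n. \<forall>y. (\<forall>i<n. y i = x i) \<longrightarrow> y \<in> {x. \<exists>n. P n x}"
    by blast
qed

text \<open>Baire category in the closed set \<open>K\<close>, inside the cylinder of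
  \<open>x0\<close> of length \<open>m0\<close>: nested cylinders centred in \<open>K\<close> avoid
  the sets \<open>C' i\<close> one after the other, and their limit lies in
  \<open>K\<close>.\<close>

lemma Baire:
  fixes K :: "'a oword set" and C' :: "'i::countable \<Rightarrow> 'a oword set"
  assumes K: "cantor_closed K" and C': "\<And>i. cantor_closed (C' i)" and x0: "x0 \<in> K"
    and dense': "\<And>x m i. x \<in> K \<Longrightarrow> (\<forall>i<m0. x i = x0 i) \<Longrightarrow>
      \<exists>y\<in>K. (\<forall>i<m. y i = x i) \<and> (\<forall>i<m0. y i = x0 i) \<and> y \<notin> C' i"
  shows "\<exists>y\<in>K. (\<forall>i<m0. y i = x0 i) \<and> (\<forall>i. y \<notin> C' i)"
proof -
  define C where "C n = C' (from_nat n)" for n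
  have C: "cantor_closed (C n)" for n by (simp add: C_def C')
  note dense = dense'[of _ _ "from_nat _", folded C_def]
  \<comment> \<open>A pair \<open>(x, m)\<close> stands for the cylinder of \<open>x\<close> of
    length \<open>m\<close>; the bound \<open>n \<le> m\<close> at stage \<open>n\<close> lets the
    lengths tend to infinity.\<close>
  define I where "I = (\<lambda>(n::nat) (x, m). x \<in> K \<and> m0 \<le> m \<and> n \<le> m \<and> (\<forall>i<m0. x i = x0 i))"
  define R where "R = (\<lambda>(n::nat) (x, m) (y, m'). (\<forall>i<m. y i = x i) \<and> m \<le> (m'::nat) \<and>
    (\<forall>z. (\<forall>i<m'. z i = y i) \<longrightarrow> z \<notin> C n))"
  have step: "\<exists>b. I (Suc n) b \<and> R n a b" if "I n a" for n a
  proof -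
    obtain x m where a: "a = (x, m)" by force
    with that have x: "x \<in> K" "m0 \<le> m" "n \<le> m" "\<forall>i<m0. x i = x0 i" by (auto simp: I_def)
    from dense[OF x(1,4)] obtain y where y: "y \<in> K" "\<forall>i<m. y i = x i" "\<forall>i<m0. y i = x0 i" "y \<notin> C n"
      by blast
    then obtain l where l: "\<And>z. (\<forall>i<l. z i = y i) \<Longrightarrow> z \<notin> C n"
      using cantor_closedD[OF C] by metis
    show ?thesis
      \<comment> \<open>Here \<open>l\<close> keeps the cylinder off \<open>C n\<close>,
        \<open>m\<close> nests it in the old one, and the successor lets the length reach
        \<open>Suc n\<close>.\<close>
      by (intro exI[of _ "(y, Suc (max l m))"]) (use x y l in \<open>auto simp: I_def R_def a\<close>)
  qed
  have "I 0 (x0, m0)" using x0 by (simp add: I_def)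
  then obtain f where f0: "f 0 = (x0, m0)" and f: "\<And>n. I n (f n) \<and> R n (f n) (f (Suc n))"
    using dependent_nat_choice[of "\<lambda>n a. I n a \<and> (n = 0 \<longrightarrow> a = (x0, m0))" R] step by (metis nat.distinct(1))
  define X where "X n = fst (f n)" for n
  define M where "M n = snd (f n)" for n
  have X: "X n \<in> K" "n \<le> M n" "m0 \<le> M n" "M n \<le> M (Suc n)" "\<And>i. i < m0 \<Longrightarrow> X n i = x0 i"
    "\<And>i. i < M n \<Longrightarrow> X (Suc n) i = X n i"
    "\<And>z. (\<forall>i<M (Suc n). z i = X (Suc n) i) \<Longrightarrow> z \<notin> C n" for n
    using f[of n] by (auto simp: I_def R_def X_def M_def split: prod.splits)
  have agree: "X (n + j) i = X n i" if "i < M n" for n j i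
  proof (induction j)
    case (Suc j)
    have "M n \<le> M (n + j)" using lift_Suc_mono_le[of M n "n + j"] X(4) by simp
    with that Suc show ?case using X(6)[of i "n + j"] by simp
  qed simp
  \<comment> \<open>Letter \<open>i\<close> is settled from stage \<open>Suc i\<close> on, where the
    cylinder has length at least \<open>Suc i\<close>.\<close>
  define y where "y i = X (Suc i) i" for i
  have y: "y i = X n i" if "i < M n" for i n
    using agree[OF that, of "Suc i"] agree[of i "Suc i" n] X(2)[of "Suc i"]
    by (simp add: y_def add.commute)
  have "y \<in> K"
  proof (rule ccontr)
    assume "y \<notin> K"
    then obtain n where n: "\<And>z. (\<forall>i<n. z i = y i) \<Longrightarrow> z \<notin> K"
      using cantor_closedD[OF K] by metis
    have "X n i = y i" if "i < n" for i
      using y[of i n] X(2)[of n] that by simp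
    then have "X n \<notin> K" by (intro n) blast
    with X(1) show False by blast
  qed
  moreover have "y i = x0 i" if "i < m0" for i
    using y[of i 0] X(3)[of 0] X(5)[of i 0] that by simp
  moreover have "y \<notin> C' i" for i
    using X(7)[of "to_nat i" y] y unfolding C_def from_nat_to_nat by blast
  ultimately show ?thesis by blast
qed

subsection \<open>Regular and aperiodic languages\<close>

text \<open>The flag \<open>ap\<close> switches aperiodicity on, so that both classes are treated at
  once.\<close>

definition aut :: "bool \<Rightarrow> 's set \<Rightarrow> 's \<Rightarrow> ('s \<Rightarrow> 'a \<Rightarrow> 's) \<Rightarrow> bool" where
  "aut ap S s0 d \<longleftrightarrow> finite S \<and> s0 \<in> S \<and> (\<forall>q\<in>S. \<forall>a. d q a \<in> S) \<and>
     (ap \<longrightarrow> (\<forall>q\<in>S. \<forall>u n. u \<noteq> [] \<and> n > 0 \<and> foldl d q (concat (replicate n u)) = q \<longrightarrow> foldl d q u = q))"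

definition langs :: "bool \<Rightarrow> 'a oword set set" where
  "langs ap = (if ap then aperiodic_langs else regular_langs)"

lemma foldl_closed: "(\<And>q a. q \<in> S \<Longrightarrow> d q a \<in> S) \<Longrightarrow> q \<in> S \<Longrightarrow> foldl d q u \<in> S"
  by (induction u arbitrary: q) auto

lemma srun_closed: "aut ap S s0 d \<Longrightarrow> q \<in> S \<Longrightarrow> srun d q x n \<in> S"
  unfolding srun_def by (rule foldl_closed) (auto simp: aut_def)

lemma infs_subset: "aut ap S s0 d \<Longrightarrow> q \<in> S \<Longrightarrow> infs d q x \<subseteq> S"
  using srun_closed[of ap S s0 d q x] by (metis infs_iff subsetI)

lemma langs_iff_nat:
  "L \<in> langs ap \<longleftrightarrow> (\<exists>S s0 d T. aut ap S s0 d \<and> T \<subseteq> Pow S \<and> L = {x. infs d (s0::nat) x \<in> T})"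
proof -
  have "muller_lang s0 d T = {x. infs d s0 x \<in> T}" for s0 T
    and d :: "nat \<Rightarrow> 'a \<Rightarrow> nat"
    by (simp add: muller_lang_def infs_def run_eq_srun)
  moreover have "aut ap S s0 d \<and> T \<subseteq> Pow S \<longleftrightarrow> is_muller S s0 d T \<and> (ap \<longrightarrow> aperiodic_aut S d)"
    for S s0 and d :: "nat \<Rightarrow> 'a \<Rightarrow> nat" and T
    unfolding aut_def is_muller_def aperiodic_aut_def ext_delta_def by argo
  ultimately show ?thesis
    by (cases ap) (simp_all add: langs_def regular_langs_def aperiodic_langs_def flip: conj_assoc)
qed

lemma infs_image:
  assumes "finite S" "\<And>n. srun d q x n \<in> S" "\<And>n. srun d' q' x n = h (srun d q x n)"
  shows "infs d' q' x = h ` infs d q x"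
proof (intro equalityI subsetI)
  fix s assume "s \<in> infs d' q' x"
  then have "\<exists>\<^sub>\<infinity>n. \<exists>t\<in>S. srun d q x n = t \<and> h t = s"
    using assms by (auto simp: INFM_nat_le infs_iff)
  then obtain t where "\<exists>\<^sub>\<infinity>n. srun d q x n = t \<and> h t = s"
    using frequently_bex_finite[OF assms(1), of "\<lambda>n t. srun d q x n = t \<and> h t = s"] by blast
  then have "t \<in> infs d q x" "h t = s" by (auto simp: INFM_nat_le infs_iff; blast)+
  then show "s \<in> h ` infs d q x" by blast
next
  fix s assume "s \<in> h ` infs d q x"
  then show "s \<in> infs d' q' x" using assms(3) by (auto simp: infs_iff) metis
qed

text \<open>The language classes ask for states in \<open>nat\<close>. The injection
  \<open>to_nat\<close> carries the automaton over and reflects cycles, so aperiodicity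
  survives.\<close>

lemma nat_automaton:
  fixes d :: "'s::countable \<Rightarrow> 'a \<Rightarrow> 's"
  assumes "aut ap S s0 d"
  shows "\<exists>S' s0' d'. aut ap S' s0' d' \<and> (\<forall>x. infs d' (s0'::nat) x = to_nat ` infs d s0 x)"
proof -
  define d' where "d' n a = to_nat (d (from_nat n) a)" for n a
  have fold: "foldl d' (to_nat q) u = to_nat (foldl d q u)" for q u
    by (induction u arbitrary: q) (auto simp: d'_def)
  have "aut ap (to_nat ` S) (to_nat s0) d'"
    unfolding aut_def ball_simps(9) fold
  proof (intro conjI ballI allI impI)
    fix q a assume "q \<in> S"
    then show "d' (to_nat q) a \<in> to_nat ` S" using assms by (simp add: aut_def d'_def)
  next
    fix q u n
    assume "ap" "q \<in> S" "u \<noteq> [] \<and> n > 0 \<and> to_nat (foldl d q (concat (replicate n u))) = to_nat q"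
    then have "foldl d q u = q" using assms unfolding aut_def to_nat_split by blast
    then show "to_nat (foldl d q u) = to_nat q" by simp
  qed (use assms in \<open>simp_all add: aut_def\<close>)
  moreover have "infs d' (to_nat s0) x = to_nat ` infs d s0 x" for x
  proof (rule infs_image)
    show "finite S" using assms by (simp add: aut_def)
    show "srun d s0 x n \<in> S" for n using assms by (intro srun_closed) (auto simp: aut_def)
  qed (simp add: srun_def fold)
  ultimately show ?thesis by blast
qed

lemma langsI:
  fixes d :: "'s::countable \<Rightarrow> 'a \<Rightarrow> 's"
  assumes "aut ap S s0 d"
  shows "{x. infs d s0 x \<in> T} \<in> langs ap"
proof -
  obtain S' d' and s0' :: nat where 1: "aut ap S' s0' d'" "\<And>x. infs d' s0' x = to_nat ` infs d s0 x"
    using nat_automaton[OF assms] by blast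
  \<comment> \<open>Acceptance sets must consist of states; the intersection loses no infinity
    set.\<close>
  let ?T = "(`) to_nat ` T \<inter> Pow S'"
  have "infs d' s0' x \<subseteq> S'" for x
    using 1(1) by (intro infs_subset) (auto simp: aut_def)
  then have "{x. infs d s0 x \<in> T} = {x. infs d' s0' x \<in> ?T}"
    by (auto simp: 1(2) inj_image_eq_iff)
  then show ?thesis
    by (intro iffD2[OF langs_iff_nat] exI conjI) (rule 1(1), rule Int_lower2)
qed

section \<open>Products of automata and Boolean combinations of languages\<close>

definition prod_step :: "('s \<Rightarrow> 'a \<Rightarrow> 's) \<Rightarrow> ('t \<Rightarrow> 'a \<Rightarrow> 't) \<Rightarrow> 's \<times> 't \<Rightarrow> 'a \<Rightarrow> 's \<times> 't" where
  "prod_step d d' q a = (d (fst q) a, d' (snd q) a)"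

lemma foldl_prod_step: "foldl (prod_step d d') (q, q') u = (foldl d q u, foldl d' q' u)"
  by (induction u arbitrary: q q') (auto simp: prod_step_def)

text \<open>A cycle in the product is a cycle in both components, so aperiodicity is
  inherited.\<close>

lemma aut_prod:
  assumes "aut ap S s d" "aut ap S' s' d'"
  shows "aut ap (S \<times> S') (s, s') (prod_step d d')"
proof -
  have "foldl d (fst q) u = fst q \<and> foldl d' (snd q) u = snd q"
    if "ap" "q \<in> S \<times> S'" "u \<noteq> []" "n > 0" "foldl (prod_step d d') q (concat (replicate n u)) = q" for q u n
    using assms that unfolding aut_def by (cases q) (metis foldl_prod_step fst_conv mem_Sigma_iff snd_conv)
  then have "foldl (prod_step d d') q u = q"
    if "ap" "q \<in> S \<times> S'" "u \<noteq> []" "n > 0" "foldl (prod_step d d') q (concat (replicate n u)) = q" for q u n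
    using that by (metis foldl_prod_step prod.collapse)
  moreover have "finite (S \<times> S')" "(s, s') \<in> S \<times> S'" "\<And>q a. q \<in> S \<times> S' \<Longrightarrow> prod_step d d' q a \<in> S \<times> S'"
    using assms by (auto simp: aut_def prod_step_def)
  ultimately show ?thesis unfolding aut_def by blast
qed

text \<open>The infinity set of a run in a product projects onto those of both factors and hence
  determines membership in all the languages.\<close>

lemma common_automaton:
  assumes "finite \<L>" "\<L> \<subseteq> langs ap"
  shows "\<exists>(S :: nat set) s0 d. aut ap S s0 d \<and>
    (\<forall>L\<in>\<L>. \<forall>x y. infs d s0 x = infs d s0 y \<longrightarrow> x \<in> L \<longrightarrow> y \<in> L)"
  using assms
proof (induction \<L> rule: finite_induct)
  case empty
  have "foldl (\<lambda>_ _. 0::nat) 0 u = 0" for u :: "'a list" by (induction u) auto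
  then have "aut ap {0::nat} 0 (\<lambda>_ _::'a. 0)" by (simp add: aut_def)
  then show ?case by auto
next
  case (insert L \<L>)
  then obtain S :: "nat set" and s0 d where 1: "aut ap S s0 d"
    "\<forall>L\<in>\<L>. \<forall>x y. infs d s0 x = infs d s0 y \<longrightarrow> x \<in> L \<longrightarrow> y \<in> L" by auto
  obtain S' s0' d' T where 2: "aut ap S' (s0' :: nat) d'" "L = {x. infs d' s0' x \<in> T}"
    using insert.prems by (auto simp: langs_iff_nat)
  let ?d = "prod_step d d'" and ?s = "(s0, s0')" and ?S = "S \<times> S'"
  have p: "aut ap ?S ?s ?d" by (rule aut_prod[OF 1(1) 2(1)])
  have s: "?s \<in> ?S" "finite ?S" using p unfolding aut_def by blast+
  note closed = srun_closed[OF p s(1)]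
  have i1: "infs d s0 x = fst ` infs ?d ?s x" for x
    by (rule infs_image[OF s(2) closed]) (simp add: srun_def foldl_prod_step)
  have i2: "infs d' s0' x = snd ` infs ?d ?s x" for x
    by (rule infs_image[OF s(2) closed]) (simp add: srun_def foldl_prod_step)
  obtain S'' D and s'' :: nat where 3: "aut ap S'' s'' D"
    "\<And>x. infs D s'' x = to_nat ` infs ?d ?s x"
    using nat_automaton[OF p] by blast
  have "infs ?d ?s x = infs ?d ?s y" if "infs D s'' x = infs D s'' y" for x y
    using that by (auto simp: 3(2) inj_image_eq_iff)
  then have "infs d s0 x = infs d s0 y \<and> infs d' s0' x = infs d' s0' y"
    if "infs D s'' x = infs D s'' y" for x y
    using that i1 i2 by metis
  then have "\<forall>L\<in>insert L \<L>. \<forall>x y. infs D s'' x = infs D s'' y \<longrightarrow> x \<in> L \<longrightarrow> y \<in> L"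
    using 1(2) 2(2) by (metis (mono_tags, lifting) insert_iff mem_Collect_eq)
  with 3(1) show ?case by blast
qed

text \<open>\<open>M\<close> is a union of atoms of the Boolean algebra generated by
  \<open>\<L>\<close>, so membership depends only on the infinity set in a common automaton.\<close>

lemma langs_Boolean:
  assumes "finite \<L>" "\<L> \<subseteq> langs ap"
    and M: "\<And>x y. (\<And>L. L \<in> \<L> \<Longrightarrow> x \<in> L \<longleftrightarrow> y \<in> L) \<Longrightarrow> x \<in> M \<Longrightarrow> y \<in> M"
  shows "M \<in> langs ap"
proof -
  obtain S :: "nat set" and s0 d where 1: "aut ap S s0 d"
    "\<And>L x y. L \<in> \<L> \<Longrightarrow> infs d s0 x = infs d s0 y \<Longrightarrow> x \<in> L \<Longrightarrow> y \<in> L"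
    using common_automaton[OF assms(1,2)] by metis
  have "M = {x. infs d s0 x \<in> infs d s0 ` M}"
  proof safe
    fix x y assume xy: "infs d s0 x = infs d s0 y" "y \<in> M"
    then have "y \<in> L \<longleftrightarrow> x \<in> L" if "L \<in> \<L>" for L
      using 1(2)[OF that, of x y] 1(2)[OF that, of y x] by auto
    then show "x \<in> M" using M xy(2) by blast
  qed auto
  then show ?thesis using langsI[OF 1(1)] by metis
qed

subsection \<open>The second level: Baire category on loops\<close>

text \<open>\<open>det2 V v \<sigma> K A\<close>: on \<open>K\<close>, \<open>A\<close> is determined by a family over the subtree of \<open>V\<close> at \<open>\<sigma>\<close>. Monotonicity of
  families plays no role in the argument and is dropped.\<close>

definition det2 :: "nat list set \<Rightarrow> (nat list \<Rightarrow> nat) \<Rightarrow> nat list \<Rightarrow> 'a oword set \<Rightarrow> ('a oword \<Rightarrow> nat) \<Rightarrow> bool" where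
  "det2 V v \<sigma> K A \<longleftrightarrow> \<sigma> \<in> V \<and> (\<exists>U. (\<forall>\<rho>\<in>V. U \<rho> \<in> Sigma02) \<and> K \<subseteq> U \<sigma> \<and>
     (\<forall>\<rho>\<in>V. prefix \<sigma> \<rho> \<longrightarrow> (\<forall>x\<in>K \<inter> tilde V U \<rho>. A x = v \<rho>)))"

definition stay :: "('s \<Rightarrow> 'a \<Rightarrow> 's) \<Rightarrow> 's set \<Rightarrow> 's \<Rightarrow> 'a oword set" where
  "stay d E q = {x. \<forall>n. srun d q x n \<in> E}"

text \<open>Strong connectivity of \<open>E\<close> by transitions inside \<open>E\<close>, phrased
  with infinite words that can be spliced directly into the category argument.\<close>

definition loop :: "('s \<Rightarrow> 'a \<Rightarrow> 's) \<Rightarrow> 's set \<Rightarrow> bool" where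
  "loop d E \<longleftrightarrow> E \<noteq> {} \<and> (\<forall>p\<in>E. \<exists>x\<in>stay d E p. infs d p x = E)"

lemma conc_0 [simp]: "conc 0 z y = y"
  by (simp add: conc_def)

lemma tilde_vimage: "tilde V (\<lambda>\<rho>. {y. f y \<in> U \<rho>}) \<sigma> = {y. f y \<in> tilde V U \<sigma>}"
  by (auto simp: tilde_def)

lemma stay_conc:
  assumes "z \<in> stay d E q" "y \<in> stay d E (srun d q z m)"
  shows "conc m z y \<in> stay d E q"
  unfolding stay_def
proof safe
  fix n
  show "srun d q (conc m z y) n \<in> E"
  proof (cases "n \<le> m")
    case True
    then show ?thesis using assms(1) by (simp add: srun_conc_le stay_def)
  next
    case False
    then obtain j where "n = m + j" by (metis le_add_diff_inverse nle_le)
    then show ?thesis using assms(2) by (simp add: srun_conc_add stay_def)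
  qed
qed

lemma infs_stay: "x \<in> stay d E q \<Longrightarrow> infs d q x \<subseteq> E"
  by (auto simp: stay_def infs_iff) metis

lemma cantor_closed_stay:
  fixes d :: "'s \<Rightarrow> 'a \<Rightarrow> 's"
  shows "cantor_closed (stay d E q)"
  unfolding stay_def
proof (rule cantor_closed_prefixes)
  fix x y :: "'a oword" and n
  assume "\<And>i. i < n \<Longrightarrow> x i = y i" "srun d q x n \<in> E"
  then show "srun d q y n \<in> E" using srun_cong[of n x y d q] by simp
qed

lemma loop_infs:
  assumes "finite S" "\<And>n. srun d q x n \<in> S"
  shows "loop d (infs d q x)"
proof -
  let ?E = "infs d q x"
  obtain n where n: "\<And>m. m \<ge> n \<Longrightarrow> srun d q x m \<in> ?E"
    using eventually_infs[OF assms, of "\<lambda>s. s \<in> ?E"] by blast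
  have "\<exists>y\<in>stay d ?E p. infs d p y = ?E" if p: "p \<in> ?E" for p
  proof -
    obtain m where m: "m \<ge> n" "srun d q x m = p" using p by (auto simp: infs_iff)
    have "(\<lambda>i. x (m + i)) \<in> stay d ?E p"
      using n m by (auto simp: stay_def simp flip: srun_shift m(2))
    then show ?thesis using infs_shift[of d q x m] m by blast
  qed
  moreover have "?E \<noteq> {}" using n by blast
  ultimately show ?thesis by (simp add: loop_def)
qed

text \<open>The sets are pulled back along prepending a prefix of \<open>z\<close>. As the image
  lies in \<open>U \<sigma>'\<close>, the root of the family may move from \<open>\<sigma>\<close>
  to \<open>\<sigma>'\<close>.\<close>

lemma det2_conc:
  assumes "\<sigma>' \<in> V" "prefix \<sigma> \<sigma>'" "\<forall>\<rho>\<in>V. U \<rho> \<in> Sigma02"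
    and "\<forall>\<rho>\<in>V. prefix \<sigma> \<rho> \<longrightarrow> (\<forall>x\<in>K \<inter> tilde V U \<rho>. A x = v \<rho>)"
    and "\<And>y. y \<in> K' \<Longrightarrow> conc m z y \<in> K \<inter> U \<sigma>' \<and> A' y = A (conc m z y)"
  shows "det2 V v \<sigma>' K' A'"
  unfolding det2_def
proof (intro conjI exI ballI impI)
  fix \<rho> assume "\<rho> \<in> V"
  then show "{y. conc m z y \<in> U \<rho>} \<in> Sigma02" using assms(3) by (simp add: Sigma02_conc)
next
  fix \<rho> x assume "\<rho> \<in> V" "prefix \<sigma>' \<rho>" "x \<in> K' \<inter> tilde V (\<lambda>\<rho>. {y. conc m z y \<in> U \<rho>}) \<rho>"
  then show "A' x = v \<rho>"
    using assms(4,5) prefix_order.trans[OF assms(2), of \<rho>] unfolding tilde_vimage by auto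
qed (use assms in auto)

lemma det2_mono:
  assumes "det2 V v \<sigma> K A" "K' \<subseteq> K"
  shows "det2 V v \<sigma> K' A"
proof -
  obtain U where "\<sigma> \<in> V" "\<forall>\<rho>\<in>V. U \<rho> \<in> Sigma02" "K \<subseteq> U \<sigma>"
    "\<forall>\<rho>\<in>V. prefix \<sigma> \<rho> \<longrightarrow> (\<forall>x\<in>K \<inter> tilde V U \<rho>. A x = v \<rho>)"
    using assms(1) by (auto simp: det2_def)
  then show ?thesis
    by (intro det2_conc[where m = 0 and U = U and \<sigma> = \<sigma> and K = K and A = A])
      (use assms(2) in auto)
qed

text \<open>At a longest node whose set has interior in the stay set, a generic word of that
  interior has infinity set \<open>E\<close> and avoids the sets of all children, so the node has
  label \<open>g E\<close>. Every state of \<open>E\<close> is reachable inside this interior, which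
  transfers the node to all of \<open>E\<close>.\<close>

lemma det2_loop:
  fixes d :: "nat \<Rightarrow> 'a \<Rightarrow> nat"
  assumes E: "loop d E" and V: "finite V" and q0: "q0 \<in> E"
    and det: "det2 V v \<sigma> (stay d E q0) (\<lambda>x. g (infs d q0 x))"
  shows "\<exists>\<sigma>'\<in>V. prefix \<sigma> \<sigma>' \<and> v \<sigma>' = g E \<and>
    (\<forall>q\<in>E. det2 V v \<sigma>' (stay d E q) (\<lambda>x. g (infs d q x)))"
proof -
  let ?K = "stay d E q0"
  obtain U where \<sigma>: "\<sigma> \<in> V" and U: "\<forall>\<rho>\<in>V. U \<rho> \<in> Sigma02" and K: "?K \<subseteq> U \<sigma>"
    and val: "\<forall>\<rho>\<in>V. prefix \<sigma> \<rho> \<longrightarrow> (\<forall>x\<in>?K \<inter> tilde V U \<rho>. g (infs d q0 x) = v \<rho>)"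
    using det by (auto simp: det2_def)
  have cover: "\<exists>w\<in>stay d E p. infs d p w = E" if "p \<in> E" for p
    using E that by (auto simp: loop_def)
  \<comment> \<open>\<open>Q \<rho>\<close> says that \<open>U \<rho>\<close> has nonempty interior
    relative to \<open>?K\<close>.\<close>
  define Q where "Q \<rho> \<longleftrightarrow> \<rho> \<in> V \<and> prefix \<sigma> \<rho> \<and>
    (\<exists>z\<in>?K. \<exists>m. \<forall>y\<in>?K. (\<forall>i<m. y i = z i) \<longrightarrow> y \<in> U \<rho>)" for \<rho>
  have "Q \<sigma>" using cover[OF q0] K \<sigma> by (auto simp: Q_def)
  moreover have "\<forall>\<rho>. Q \<rho> \<longrightarrow> length \<rho> < Suc (Max (length ` V))"
    using V by (auto simp: Q_def less_Suc_eq_le)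
  ultimately obtain \<sigma>' where Q: "Q \<sigma>'" and max: "\<And>\<rho>. Q \<rho> \<Longrightarrow> length \<rho> \<le> length \<sigma>'"
    using ex_has_greatest_nat[of Q \<sigma> length "Suc (Max (length ` V))"] by blast
  obtain z m where \<sigma>': "\<sigma>' \<in> V" "prefix \<sigma> \<sigma>'" and z: "z \<in> ?K"
    and m: "\<And>y. y \<in> ?K \<Longrightarrow> (\<forall>i<m. y i = z i) \<Longrightarrow> y \<in> U \<sigma>'"
    using Q by (auto simp: Q_def)
  have "\<exists>C. (\<forall>n. cantor_closed (C n)) \<and> U \<rho> = (\<Union>n::nat. C n)" if "\<rho> \<in> V" for \<rho>
    using U that by (simp add: Sigma02_def)
  then obtain C where C: "\<And>\<rho> n. \<rho> \<in> V \<Longrightarrow> cantor_closed (C \<rho> n)" "\<And>\<rho>. \<rho> \<in> V \<Longrightarrow> U \<rho> = (\<Union>n::nat. C \<rho> n)"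
    by metis
  \<comment> \<open>The closed sets to be avoided: if \<open>visit\<close> holds, the words missing
    the state \<open>i\<close> of \<open>E\<close> from time \<open>n\<close> on; otherwise the
    pieces of the set of the child \<open>i\<close>. Unsuitable indices give the empty set.\<close>
  define T where "T = (\<lambda>(i, n, visit). if visit then if i \<in> E then {x. \<forall>j. n \<le> j \<longrightarrow> srun d q0 x j \<noteq> i} else {}
    else if \<sigma>' @ [i] \<in> V then C (\<sigma>' @ [i]) n else {})"
  have "\<exists>y\<in>?K. (\<forall>i<m. y i = z i) \<and> (\<forall>t. y \<notin> T t)"
  proof (rule Baire[OF cantor_closed_stay _ z])
    fix t :: "nat \<times> nat \<times> bool"
    obtain i n visit where t: "t = (i, n, visit)" by (cases t) auto
    have "cantor_closed {x. \<forall>j. n \<le> j \<longrightarrow> srun d q0 x j \<noteq> i}"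
    proof (rule cantor_closed_prefixes)
      fix x y :: "'a oword" and j
      assume "\<And>i. i < j \<Longrightarrow> x i = y i" "n \<le> j \<longrightarrow> srun d q0 x j \<noteq> i"
      then show "n \<le> j \<longrightarrow> srun d q0 y j \<noteq> i" using srun_cong[of j x y d q0] by simp
    qed
    moreover have "cantor_closed ({} :: 'a oword set)"
      by (simp add: cantor_closed_def cantor_open_def)
    ultimately show "cantor_closed (T t)"
      using C(1)[of "\<sigma>' @ [i]" n] by (simp add: T_def t)
    fix x k assume x: "x \<in> ?K" "\<forall>i<m. x i = z i"
    show "\<exists>y\<in>?K. (\<forall>i<k. y i = x i) \<and> (\<forall>i<m. y i = z i) \<and> y \<notin> T t"
    proof (cases visit)
      case True
      \<comment> \<open>The sum exceeds both prescribed lengths; beyond it the word continues so as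
        to visit all of \<open>E\<close> infinitely often.\<close>
      define M where "M = m + k"
      have "srun d q0 x M \<in> E" using x by (simp add: stay_def)
      then obtain w where w: "w \<in> stay d E (srun d q0 x M)" "infs d (srun d q0 x M) w = E"
        using cover by blast
      let ?y = "conc M x w"
      have "?y \<in> ?K" using x w by (intro stay_conc)
      moreover have "infs d q0 ?y = E" using w by (simp add: infs_conc)
      then have "?y \<notin> T t" using True by (auto simp: T_def t infs_iff)
      ultimately show ?thesis using x(2) by (intro bexI[of _ ?y]) (auto simp: M_def)
    next
      case False
      show ?thesis
      proof (cases "\<sigma>' @ [i] \<in> V")
        case V: True
        then have "\<not> Q (\<sigma>' @ [i])" using max by fastforce
        moreover have "prefix \<sigma> (\<sigma>' @ [i])" using \<sigma>'(2) by (rule prefix_prefix)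
        ultimately have "\<forall>z\<in>?K. \<forall>n. \<exists>y\<in>?K. (\<forall>j<n. y j = z j) \<and> y \<notin> U (\<sigma>' @ [i])"
          unfolding Q_def using V by blast
        then obtain y where y: "y \<in> ?K" "\<forall>j<m + k. y j = x j" "y \<notin> U (\<sigma>' @ [i])"
          using x(1) by blast
        then have "y \<notin> T t" using False C(2)[OF V] by (auto simp: T_def t)
        then show ?thesis using y x(2) by (intro bexI[of _ y]) auto
      qed (use False x in \<open>auto simp: T_def t\<close>)
    qed
  qed
  then obtain y where y: "y \<in> ?K" "\<forall>i<m. y i = z i" "\<And>t. y \<notin> T t" by blast
  have "E \<subseteq> infs d q0 y"
  proof
    fix p assume "p \<in> E"
    then have "\<exists>j\<ge>n. srun d q0 y j = p" for n
      using y(3)[of "(p, n, True)"] by (auto simp: T_def)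
    then show "p \<in> infs d q0 y" by (simp add: infs_iff)
  qed
  then have "infs d q0 y = E" using infs_stay[OF y(1)] by blast
  moreover have "y \<in> tilde V U \<sigma>'"
  proof -
    have "y \<notin> U (\<sigma>' @ [i])" if "\<sigma>' @ [i] \<in> V" for i
    proof -
      have "y \<notin> C (\<sigma>' @ [i]) n" for n
        using y(3)[of "(i, n, False)"] that by (simp add: T_def)
      then show ?thesis using C(2)[OF that] by blast
    qed
    then show ?thesis using m y by (auto simp: tilde_def)
  qed
  ultimately have "v \<sigma>' = g E" using val \<sigma>' y(1) by auto
  moreover have "det2 V v \<sigma>' (stay d E q) (\<lambda>x. g (infs d q x))" if q: "q \<in> E" for q
  proof -
    \<comment> \<open>After \<open>m\<close> letters of \<open>z\<close> a word through
      \<open>E\<close> is followed until \<open>q\<close> is reached; any continuation staying in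
      \<open>E\<close> remains in the cylinder where \<open>U \<sigma>'\<close> covers
      \<open>?K\<close>.\<close>
    have "srun d q0 z m \<in> E" using z by (simp add: stay_def)
    then obtain w where w: "w \<in> stay d E (srun d q0 z m)" "infs d (srun d q0 z m) w = E"
      using cover by blast
    then obtain j where j: "srun d (srun d q0 z m) w j = q" using q by (metis infs_iff)
    let ?z = "conc m z w" and ?m = "m + j"
    have z': "?z \<in> ?K" using z w by (intro stay_conc)
    have q': "srun d q0 ?z ?m = q" by (simp add: srun_conc_add j)
    show ?thesis
    proof (rule det2_conc[OF \<sigma>' U val])
      fix y assume "y \<in> stay d E q"
      then have "conc ?m ?z y \<in> ?K" by (intro stay_conc[OF z']) (simp add: q')
      moreover have "\<forall>i<m. conc ?m ?z y i = z i" by simp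
      ultimately show "conc ?m ?z y \<in> ?K \<inter> U \<sigma>' \<and>
          g (infs d q y) = g (infs d q0 (conc ?m ?z y))"
        using m by (simp add: infs_conc q')
    qed
  qed
  ultimately show ?thesis using \<sigma>' by blast
qed

text \<open>The list \<open>s\<close> records the states not visited any more, ordered by their last visits.\<close>

lemma history_choice:
  fixes d :: "nat \<Rightarrow> 'a \<Rightarrow> nat"
  assumes V: "finite V" "[] \<in> V" and P: "P \<subseteq> S"
    and det: "\<And>q. q \<in> P \<Longrightarrow> det2 V v [] (stay d P q) (\<lambda>x. g (infs d q x))"
  shows "\<exists>H. (\<forall>s. H s \<in> V) \<and> (\<forall>s s'. prefix s s' \<longrightarrow> prefix (H s) (H s')) \<and>
    (\<forall>s. loop d (S - set s) \<longrightarrow> S - set s \<subseteq> P \<longrightarrow> v (H s) = g (S - set s))"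
proof -
  \<comment> \<open>The invariant \<open>I\<close> says that the node still serves all runs confined
    to \<open>P\<close> without \<open>s\<close>; \<open>G\<close> asks for the right label at the
    history \<open>s\<close>.\<close>
  define I where "I s \<sigma> \<longleftrightarrow> \<sigma> \<in> V \<and>
    (\<forall>q\<in>P - set s. det2 V v \<sigma> (stay d (P - set s) q) (\<lambda>x. g (infs d q x)))" for s \<sigma>
  define G where "G s \<sigma> \<longleftrightarrow> (loop d (S - set s) \<longrightarrow> S - set s \<subseteq> P \<longrightarrow> v \<sigma> = g (S - set s))" for s \<sigma>
  have step: "\<exists>\<sigma>'. prefix \<sigma> \<sigma>' \<and> I s' \<sigma>' \<and> G s' \<sigma>'" if I: "I s \<sigma>" "set s \<subseteq> set s'" for s s' \<sigma>
  proof -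
    have "stay d (P - set s') q \<subseteq> stay d (P - set s) q" for q
      using I(2) by (auto simp: stay_def)
    then have "det2 V v \<sigma> (stay d (P - set s') q) (\<lambda>x. g (infs d q x))" if "q \<in> P - set s'" for q
      using I that det2_mono unfolding I_def by (meson Diff_mono order_refl subsetD)
    then have I': "I s' \<sigma>" using I by (simp add: I_def)
    show ?thesis
    proof (cases "loop d (S - set s') \<and> S - set s' \<subseteq> P")
      case True
      then have E: "P - set s' = S - set s'" using P by blast
      from True obtain q where q: "q \<in> S - set s'" by (auto simp: loop_def)
      show ?thesis
        using det2_loop[of d "S - set s'" V q v \<sigma> g] True V(1) q I' by (auto simp: I_def G_def E)
    qed (use I' in \<open>auto simp: G_def\<close>)
  qed
  have "I [] []" using V det by (simp add: I_def)
  \<comment> \<open>The empty history needs a step of its own, as \<open>S\<close> itself may be a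
    loop.\<close>
  then obtain \<sigma>0 where \<sigma>0: "I [] \<sigma>0" "G [] \<sigma>0" using step[of "[]" "[]" "[]"] by blast
  have "\<forall>s p \<sigma>. \<exists>\<sigma>'. I s \<sigma> \<longrightarrow> prefix \<sigma> \<sigma>' \<and> I (s @ [p]) \<sigma>' \<and> G (s @ [p]) \<sigma>'"
  proof (intro allI)
    fix s p \<sigma>
    show "\<exists>\<sigma>'. I s \<sigma> \<longrightarrow> prefix \<sigma> \<sigma>' \<and> I (s @ [p]) \<sigma>' \<and> G (s @ [p]) \<sigma>'"
      using step[of s \<sigma> "s @ [p]"] by auto
  qed
  then obtain F where F: "\<And>s p \<sigma>. I s \<sigma> \<Longrightarrow> prefix \<sigma> (F s p \<sigma>) \<and> I (s @ [p]) (F s p \<sigma>) \<and> G (s @ [p]) (F s p \<sigma>)"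
    by metis
  \<comment> \<open>Recursion on the reversed list: appending a state to the history extends the
    node chosen for the shorter history.\<close>
  define H where "H s = rec_list \<sigma>0 (\<lambda>p r. F (rev r) p) (rev s)" for s
  have H: "H [] = \<sigma>0" "H (s @ [p]) = F s p (H s)" for s p by (simp_all add: H_def)
  have IG: "I s (H s) \<and> G s (H s)" for s
    by (induction s rule: rev_induct) (use \<sigma>0 F in \<open>auto simp: H\<close>)
  have "prefix (H s) (H (s @ t))" for s t
  proof (induction t rule: rev_induct)
    case (snoc p t)
    have "prefix (H (s @ t)) (H (s @ t @ [p]))" using H(2)[of "s @ t" p] F IG by simp
    with snoc show ?case by (metis prefix_order.trans)
  qed simp
  then show ?thesis using IG by (intro exI[of _ H]) (auto simp: I_def G_def prefix_def)
qed

subsection \<open>Latest appearance records\<close>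

text \<open>The latest state stands last, so states no longer visited drift to the front.\<close>

definition lar :: "'s list \<Rightarrow> 's \<Rightarrow> 's list" where
  "lar l q = removeAll q l @ [q]"

text \<open>\<open>remdups\<close> keeps last occurrences, which is the order of latest
  visits.\<close>

lemma foldl_lar: "foldl lar l vs = filter (\<lambda>q. q \<notin> set vs) l @ remdups vs"
proof (induction vs rule: rev_induct)
  case (snoc q vs)
  have "remdups (vs @ [q]) = removeAll q (remdups vs) @ [q]"
    by (induction vs) auto
  then show ?case using snoc by (auto simp: lar_def removeAll_filter_not_eq intro: filter_cong)
qed simp

lemma foldl_lar_replicate:
  "n > 0 \<Longrightarrow> foldl lar l (concat (replicate n vs)) = foldl lar l vs"
proof (induction n)
  case (Suc n)
  have "foldl lar (foldl lar l vs) vs = foldl lar l vs"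
    by (simp add: foldl_lar)
  then have "foldl lar (foldl lar l vs) (concat (replicate n vs)) = foldl lar l vs" for n
    by (induction n) auto
  then show ?case by simp
qed simp

lemma set_lar: "q \<in> S \<Longrightarrow> set l = S \<Longrightarrow> set (lar l q) = S"
  by (auto simp: lar_def)

lemma distinct_lar: "distinct l \<Longrightarrow> distinct (lar l q)"
  by (simp add: lar_def distinct_removeAll)

text \<open>From some time on only recurring states are visited, and in the end each of them has
  been visited again. These visits move them behind all others, whose order is thereby
  frozen.\<close>

lemma lar_limit:
  assumes S: "finite S" "\<And>n. srun d q x n \<in> S"
    and l: "\<And>n. l (Suc n) = lar (l n) (srun d q x (Suc n))" "\<And>n. set (l n) = S"
  shows "\<exists>s n. set s = S - infs d q x \<and> (\<forall>m\<ge>n. prefix s (l m))"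
proof -
  let ?E = "infs d q x" and ?r = "srun d q x"
  obtain N where N: "\<And>m. m \<ge> N \<Longrightarrow> ?r m \<in> ?E"
    using eventually_infs[OF S, of "\<lambda>s. s \<in> ?E"] by blast
  have "finite ?E" using S by (auto simp: infs_iff intro!: finite_subset[OF _ S(1)]) metis
  moreover have "eventually (\<lambda>n. e \<in> ?r ` {Suc N..<Suc n}) sequentially" if e: "e \<in> ?E" for e
  proof -
    obtain m where "m \<ge> Suc N" "?r m = e" using e by (metis infs_iff)
    then show ?thesis unfolding eventually_sequentially by (intro exI[of _ m]) force
  qed
  ultimately have "eventually (\<lambda>n. \<forall>e\<in>?E. e \<in> ?r ` {Suc N..<Suc n}) sequentially"
    by (intro eventually_ball_finite) auto
  then obtain n where n: "\<And>m. m \<ge> n \<Longrightarrow> ?E \<subseteq> ?r ` {Suc N..<Suc m}"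
    by (auto simp: eventually_sequentially)
  \<comment> \<open>The update producing \<open>l (Suc N)\<close> enters the state at time
    \<open>Suc N\<close>, hence the range from \<open>Suc N\<close> to \<open>m\<close>.\<close>
  have fold: "l m = foldl lar (l N) (map ?r [Suc N..<Suc m])" if "m \<ge> N" for m
    using that by (induction m rule: dec_induct) (auto simp: l(1) simp del: srun_simps)
  let ?s = "filter (\<lambda>q. q \<notin> ?E) (l N)"
  have "prefix ?s (l m)" if m: "m \<ge> max n N" for m
  proof -
    have "set (map ?r [Suc N..<Suc m]) = ?E"
    proof
      show "set (map ?r [Suc N..<Suc m]) \<subseteq> ?E" using N by (auto simp del: srun_simps upt_Suc)
      show "?E \<subseteq> set (map ?r [Suc N..<Suc m])" using n[of m] m by (simp del: srun_simps upt_Suc)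
    qed
    then show ?thesis using fold[of m] m by (simp only: foldl_lar) simp
  qed
  moreover have "set ?s = S - ?E" using l(2) by auto
  ultimately show ?thesis by blast
qed

text \<open>At a late visit a recurring state stands last in the record, beyond \<open>s\<close>
  since \<open>s\<close> does not exhaust \<open>S\<close>; by distinctness it is not in
  \<open>s\<close>.\<close>

lemma lar_stable_prefix:
  assumes l: "\<And>n. l (Suc n) = lar (l n) (srun d q x (Suc n))" "\<And>n. set (l n) = S" "\<And>n. distinct (l n)"
    and s: "\<And>m. m \<ge> n \<Longrightarrow> prefix s (l m)" "S - set s \<noteq> {}"
  shows "set s \<inter> infs d q x = {}"
proof (rule ccontr)
  assume "\<not> ?thesis"
  then obtain p where p: "p \<in> set s" "p \<in> infs d q x" by blast
  then obtain m where m: "m \<ge> Suc n" "srun d q x m = p" by (metis infs_iff)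
  then obtain m' where m': "m = Suc m'" by (cases m) auto
  obtain r where r: "l m = s @ r" using s(1)[of m] m(1) by (auto simp: prefix_def)
  have "r \<noteq> []" using s(2) l(2)[of m] r by auto
  moreover have "last (l m) = p" using l(1)[of m'] m m' by (simp add: lar_def del: srun_simps)
  ultimately have "p \<in> set r" using r by (metis last_appendR last_in_set)
  then show False using p(1) l(3)[of m] r by auto
qed

subsection \<open>The first level\<close>

lemma prefix_snoc:
  assumes "prefix \<sigma> \<tau>" "\<tau> \<noteq> \<sigma>"
  shows "\<exists>i. prefix (\<sigma> @ [i]) \<tau>"
proof -
  obtain r where r: "\<tau> = \<sigma> @ r" using assms(1) by (auto simp: prefix_def)
  with assms(2) obtain i r' where "r = i # r'" by (cases r) auto
  with r show ?thesis by (intro exI[of _ i]) simp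
qed

text \<open>The node \<open>[]\<close>, which is not in \<open>F\<close>, serves as a root below the forest: its component must be
  empty.\<close>

definition det1 :: "nat list set \<Rightarrow> (nat list \<Rightarrow> nat list set \<times> (nat list \<Rightarrow> nat)) \<Rightarrow> nat list \<Rightarrow>
    ('a oword \<Rightarrow> nat) \<Rightarrow> bool" where
  "det1 F c \<tau> A \<longleftrightarrow> (\<exists>U. (\<forall>\<rho>. cantor_open (U \<rho>)) \<and> U \<tau> = UNIV \<and>
     (\<forall>\<rho>\<in>insert [] F. prefix \<tau> \<rho> \<longrightarrow> tilde F U \<rho> = {} \<or>
        \<rho> \<in> F \<and> det2 (fst (c \<rho>)) (snd (c \<rho>)) [] (tilde F U \<rho>) A))"

text \<open>Prepending the prefix lands in \<open>U \<tau>'\<close>, so the pulled-back set at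
  \<open>\<tau>'\<close> is the whole space and the family above \<open>\<tau>'\<close>
  suffices.\<close>

lemma det1_subtree:
  assumes U: "\<And>\<rho>. cantor_open (U \<rho>)"
    and det: "\<And>\<rho>. \<rho> \<in> insert [] F \<Longrightarrow> prefix \<tau> \<rho> \<Longrightarrow> tilde F U \<rho> = {} \<or>
        \<rho> \<in> F \<and> det2 (fst (c \<rho>)) (snd (c \<rho>)) [] (tilde F U \<rho>) A"
    and \<tau>': "prefix \<tau> \<tau>'" "\<And>y. conc m z y \<in> U \<tau>'"
  shows "det1 F c \<tau>' (\<lambda>y. A (conc m z y))"
  unfolding det1_def
proof (intro exI[of _ "\<lambda>\<rho>. {y. conc m z y \<in> U \<rho>}"] conjI allI ballI impI)
  fix \<rho> assume \<rho>: "\<rho> \<in> insert [] F" "prefix \<tau>' \<rho>"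
  have "prefix \<tau> \<rho>" using \<rho>(2) \<tau>'(1) by (rule prefix_order.trans[rotated])
  then consider "tilde F U \<rho> = {}" | "\<rho> \<in> F" "det2 (fst (c \<rho>)) (snd (c \<rho>)) [] (tilde F U \<rho>) A"
    using det \<rho>(1) by blast
  then show "tilde F (\<lambda>\<rho>. {y. conc m z y \<in> U \<rho>}) \<rho> = {} \<or>
        \<rho> \<in> F \<and> det2 (fst (c \<rho>)) (snd (c \<rho>)) [] (tilde F (\<lambda>\<rho>. {y. conc m z y \<in> U \<rho>}) \<rho>)
          (\<lambda>y. A (conc m z y))"
  proof cases
    case 2
    then obtain W where "[] \<in> fst (c \<rho>)" and W: "\<forall>\<sigma>\<in>fst (c \<rho>). W \<sigma> \<in> Sigma02" "tilde F U \<rho> \<subseteq> W []"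
      "\<forall>\<sigma>\<in>fst (c \<rho>). prefix [] \<sigma> \<longrightarrow> (\<forall>x\<in>tilde F U \<rho> \<inter> tilde (fst (c \<rho>)) W \<sigma>. A x = snd (c \<rho>) \<sigma>)"
      unfolding det2_def by blast
    then have "det2 (fst (c \<rho>)) (snd (c \<rho>)) [] {y. conc m z y \<in> tilde F U \<rho>} (\<lambda>y. A (conc m z y))"
      by (intro det2_conc[where U = W and \<sigma> = "[]" and K = "tilde F U \<rho>"]) auto
    then show ?thesis using 2 by (simp add: tilde_vimage)
  qed (simp add: tilde_vimage)
qed (use U \<tau>' in \<open>auto intro: cantor_open_conc\<close>)

text \<open>This keeps a node available at all states reachable from a state that admits it.\<close>

lemma det1_conc:
  assumes "det1 F c \<tau> A"
  shows "det1 F c \<tau> (\<lambda>y. A (conc m z y))"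
proof -
  obtain U where "\<forall>\<rho>. cantor_open (U \<rho>)" "U \<tau> = UNIV" "\<forall>\<rho>\<in>insert [] F. prefix \<tau> \<rho> \<longrightarrow> tilde F U \<rho> = {} \<or>
        \<rho> \<in> F \<and> det2 (fst (c \<rho>)) (snd (c \<rho>)) [] (tilde F U \<rho>) A"
    using assms unfolding det1_def by blast
  then show ?thesis by (intro det1_subtree[where U = U and \<tau> = \<tau>]) auto
qed

lemma det2_empty: "[] \<in> V \<Longrightarrow> det2 V v [] {} A"
proof -
  have "cantor_closed ({} :: 'a oword set)" by (simp add: cantor_closed_def cantor_open_def)
  then have "{} \<in> (Sigma02 :: 'a oword set set)" using Sigma02_UN_countable[of "\<lambda>_::nat. {}"] by simp
  then show "[] \<in> V \<Longrightarrow> det2 V v [] {} A" unfolding det2_def by (intro conjI exI[of _ "\<lambda>_. {}"]) auto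
qed

section \<open>Maximal forest nodes of states\<close>

locale determined_aut =
  fixes ap :: bool and S :: "nat set" and s0 :: nat and d :: "nat \<Rightarrow> 'a \<Rightarrow> nat"
    and g :: "nat set \<Rightarrow> nat" and k :: nat and F c
  assumes aut: "aut ap S s0 d"
    and forest: "is_Tk_forest k F c"
    and det: "det1 F c [] (\<lambda>x. g (infs d s0 x))"
begin

abbreviation A :: "nat \<Rightarrow> 'a oword \<Rightarrow> nat" where "A q x \<equiv> g (infs d q x)"

text \<open>These sets may overlap, since a state can have several maximal nodes.\<close>

definition P :: "nat list \<Rightarrow> nat set" where
  "P \<tau> = {q\<in>S. det1 F c \<tau> (A q) \<and> (\<forall>\<tau>'\<in>F. prefix \<tau> \<tau>' \<longrightarrow> det1 F c \<tau>' (A q) \<longrightarrow> \<tau>' = \<tau>)}"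

lemma finite_F: "finite F"
  and F_prefix: "\<tau> \<in> F \<Longrightarrow> prefix \<rho> \<tau> \<Longrightarrow> \<rho> \<noteq> [] \<Longrightarrow> \<rho> \<in> F"
  using forest by (auto simp: is_Tk_forest_def is_forest_def prefix_def)

lemma finite_V: "\<tau> \<in> F \<Longrightarrow> finite (fst (c \<tau>))" and Nil_V: "\<tau> \<in> F \<Longrightarrow> [] \<in> fst (c \<tau>)"
  and V_prefix: "\<tau> \<in> F \<Longrightarrow> \<sigma> \<in> fst (c \<tau>) \<Longrightarrow> prefix \<rho> \<sigma> \<Longrightarrow> \<rho> \<in> fst (c \<tau>)"
  using forest by (auto simp: is_Tk_forest_def is_ktree_def Let_def prefix_def)

lemma S: "finite S" "s0 \<in> S" "\<And>q a. q \<in> S \<Longrightarrow> d q a \<in> S"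
  using aut by (auto simp: aut_def)

text \<open>If a word staying in \<open>P \<tau>\<close> lay in the open set of a child, so would a
  whole cylinder around it, and the state reached after that prefix would admit the child against
  maximality. Thus the word lies in the component of \<open>\<tau>\<close>, which is empty for the
  artificial root.\<close>

lemma stay_P:
  assumes \<tau>: "\<tau> \<in> insert [] F" and q: "q \<in> P \<tau>"
  shows "if \<tau> \<in> F then det2 (fst (c \<tau>)) (snd (c \<tau>)) [] (stay d (P \<tau>) q) (A q) else stay d (P \<tau>) q = {}"
proof -
  have "det1 F c \<tau> (A q)" using q by (simp add: P_def)
  then obtain U where U: "\<forall>\<rho>. cantor_open (U \<rho>)" "U \<tau> = UNIV" "\<forall>\<rho>\<in>insert [] F. prefix \<tau> \<rho> \<longrightarrow> tilde F U \<rho> = {} \<or>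
        \<rho> \<in> F \<and> det2 (fst (c \<rho>)) (snd (c \<rho>)) [] (tilde F U \<rho>) (A q)"
    unfolding det1_def by blast
  have "x \<notin> U (\<tau> @ [i])" if x: "x \<in> stay d (P \<tau>) q" and i: "\<tau> @ [i] \<in> F" for x i
  proof
    assume "x \<in> U (\<tau> @ [i])"
    then obtain m where m: "\<And>y. (\<forall>i<m. y i = x i) \<Longrightarrow> y \<in> U (\<tau> @ [i])"
      using U(1) unfolding cantor_open_def by metis
    have "det1 F c (\<tau> @ [i]) (\<lambda>y. A q (conc m x y))"
      by (rule det1_subtree[where U = U and \<tau> = \<tau>]) (use U m in auto)
    then have "det1 F c (\<tau> @ [i]) (A (srun d q x m))" by (simp add: infs_conc)
    moreover have "srun d q x m \<in> P \<tau>" using x by (simp add: stay_def)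
    ultimately show False using i by (force simp: P_def)
  qed
  then have stay: "stay d (P \<tau>) q \<subseteq> tilde F U \<tau>" using U(2) by (auto simp: tilde_def)
  from \<tau> U(3) consider "tilde F U \<tau> = {}"
    | "\<tau> \<in> F" "det2 (fst (c \<tau>)) (snd (c \<tau>)) [] (tilde F U \<tau>) (A q)" by blast
  then show ?thesis
  proof cases
    case 1
    then have "stay d (P \<tau>) q = {}" using stay by blast
    then show ?thesis by (auto intro: det2_empty Nil_V)
  next
    case 2
    then show ?thesis using stay det2_mono by auto
  qed
qed

definition up :: "nat list \<Rightarrow> nat \<Rightarrow> nat list" where
  "up \<tau> q = (SOME \<tau>'. prefix \<tau> \<tau>' \<and> \<tau>' \<in> insert [] F \<and> q \<in> P \<tau>')"

text \<open>A longest admissible node above \<open>\<tau>\<close> is maximal.\<close>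

lemma up:
  assumes "\<tau> \<in> insert [] F" "q \<in> S" "det1 F c \<tau> (A q)"
  shows "prefix \<tau> (up \<tau> q) \<and> up \<tau> q \<in> insert [] F \<and> q \<in> P (up \<tau> q)"
  unfolding up_def
proof (rule someI_ex)
  define Q where "Q \<tau>' \<longleftrightarrow> prefix \<tau> \<tau>' \<and> \<tau>' \<in> insert [] F \<and> det1 F c \<tau>' (A q)" for \<tau>'
  have "Q \<tau>" using assms by (simp add: Q_def)
  moreover have "\<forall>\<rho>. Q \<rho> \<longrightarrow> length \<rho> < Suc (Max (length ` insert [] F))"
    using finite_F by (auto simp: Q_def less_Suc_eq_le intro!: Max_ge)
  ultimately obtain \<tau>' where \<tau>': "Q \<tau>'" "\<And>\<rho>. Q \<rho> \<Longrightarrow> length \<rho> \<le> length \<tau>'"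
    using ex_has_greatest_nat[of Q \<tau> length "Suc (Max (length ` insert [] F))"] by blast
  have "\<rho> = \<tau>'" if "\<rho> \<in> F" "prefix \<tau>' \<rho>" "det1 F c \<rho> (A q)" for \<rho>
  proof -
    have "Q \<rho>" using that \<tau>'(1) prefix_order.trans[of \<tau> \<tau>' \<rho>] by (simp add: Q_def)
    then show ?thesis using \<tau>'(2)[of \<rho>] that(2) by (auto simp: prefix_def)
  qed
  then have "prefix \<tau> \<tau>' \<and> \<tau>' \<in> insert [] F \<and> q \<in> P \<tau>'"
    using \<tau>'(1) assms(2) by (auto simp: Q_def P_def)
  then show "\<exists>\<tau>'. prefix \<tau> \<tau>' \<and> \<tau>' \<in> insert [] F \<and> q \<in> P \<tau>'" by blast
qed

section \<open>The automaton extended by a forest node and a record\<close>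

definition nxt :: "nat \<times> nat list \<times> nat list \<Rightarrow> 'a \<Rightarrow> nat \<times> nat list \<times> nat list" where
  "nxt t a = (let q = d (fst t) a in (q, up (fst (snd t)) q, lar (snd (snd t)) q))"

text \<open>The record starts as an arbitrary enumeration of \<open>S\<close>, so that it always
  contains each state exactly once.\<close>

definition start :: "nat \<times> nat list \<times> nat list" where
  "start = (s0, up [] s0, sorted_list_of_set S)"

definition states :: "(nat \<times> nat list \<times> nat list) set" where
  "states = {(q, \<tau>, l). \<tau> \<in> insert [] F \<and> q \<in> P \<tau> \<and> set l = S \<and> distinct l}"

lemma nxt_states:
  assumes "t \<in> states"
  shows "nxt t a \<in> states" "prefix (fst (snd t)) (fst (snd (nxt t a)))"
proof -
  obtain q \<tau> l where t: "t = (q, \<tau>, l)" by (cases t)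
  then have q: "\<tau> \<in> insert [] F" "q \<in> S" "det1 F c \<tau> (A q)" "set l = S" "distinct l"
    using assms by (auto simp: states_def P_def)
  then have "d q a \<in> S" using S by blast
  moreover have "det1 F c \<tau> (A (d q a))"
    using det1_conc[OF q(3), of "Suc 0" "\<lambda>_. a"] by (simp add: infs_conc)
  ultimately show "nxt t a \<in> states" "prefix (fst (snd t)) (fst (snd (nxt t a)))"
    using up[OF q(1), of "d q a"] q set_lar[of "d q a" S l] distinct_lar[of l]
    by (auto simp: nxt_def t states_def Let_def)
qed

lemma start_states: "start \<in> states"
  using up[of "[]" s0] S det by (auto simp: start_def states_def)

lemma foldl_states: "t \<in> states \<Longrightarrow> foldl nxt t u \<in> states"
  by (rule foldl_closed) (rule nxt_states)

lemma foldl_up: "t \<in> states \<Longrightarrow> prefix (fst (snd t)) (fst (snd (foldl nxt t u)))"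
proof (induction u arbitrary: t)
  case (Cons a u)
  then show ?case using nxt_states[of t a] prefix_order.trans by fastforce
qed simp

text \<open>The first state is left out and the last one included, as in the updates of the record
  by \<open>nxt\<close>.\<close>

primrec visits :: "nat \<Rightarrow> 'a list \<Rightarrow> nat list" where
  "visits q [] = []"
| "visits q (a # u) = d q a # visits (d q a) u"

lemma foldl_nxt_fst: "fst (foldl nxt t u) = foldl d (fst t) u"
  by (induction u arbitrary: t) (auto simp: nxt_def Let_def)

lemma foldl_nxt_lar: "snd (snd (foldl nxt t u)) = foldl lar (snd (snd t)) (visits (fst t) u)"
  by (induction u arbitrary: t) (auto simp: nxt_def Let_def)

lemma visits_append: "visits q (u @ w) = visits q u @ visits (foldl d q u) w"
  by (induction u arbitrary: q) auto

lemma visits_replicate: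
  "foldl d q u = q \<Longrightarrow> visits q (concat (replicate n u)) = concat (replicate n (visits q u))"
  by (induction n) (auto simp: visits_append)

text \<open>Let a power of \<open>u\<close> fix an extended state. Then \<open>u\<close> fixes the
  original state by aperiodicity, the node because nodes only move up and must return, and the
  record because \<open>u\<close> acts on it idempotently.\<close>

lemma aut_nxt: "aut ap states start nxt"
  unfolding aut_def
proof (intro conjI ballI allI impI)
  have "states \<subseteq> S \<times> insert [] F \<times> {l. set l \<subseteq> S \<and> distinct l}"
    by (auto simp: states_def P_def)
  moreover have "finite (S \<times> insert [] F \<times> {l. set l \<subseteq> S \<and> distinct l})"
    using S finite_F finite_subset_distinct by blast
  ultimately show "finite states" by (rule finite_subset)
next
  fix t u n
  assume ap: ap and t: "t \<in> states" and u: "u \<noteq> [] \<and> n > 0 \<and> foldl nxt t (concat (replicate n u)) = t"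
  have "fst t \<in> S" using t by (auto simp: states_def P_def)
  moreover have "foldl d (fst t) (concat (replicate n u)) = fst t"
    using u by (metis foldl_nxt_fst)
  ultimately have q: "foldl d (fst t) u = fst t"
    using aut ap u unfolding aut_def by blast
  obtain n' where n': "n = Suc n'" using u by (cases n) auto
  have "prefix (fst (snd t)) (fst (snd (foldl nxt t u)))" using t by (rule foldl_up)
  moreover have "prefix (fst (snd (foldl nxt t u))) (fst (snd t))"
    using foldl_up[OF foldl_states[OF t], of u "concat (replicate n' u)"] u by (simp add: n')
  ultimately have \<tau>: "fst (snd (foldl nxt t u)) = fst (snd t)" by (rule prefix_order.antisym[rotated])
  have "snd (snd t) = foldl lar (snd (snd t)) (concat (replicate n (visits (fst t) u)))"
    using u foldl_nxt_lar[of t "concat (replicate n u)"] visits_replicate[OF q] by simp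
  then have "snd (snd (foldl nxt t u)) = snd (snd t)"
    using u by (simp add: foldl_nxt_lar foldl_lar_replicate)
  then show "foldl nxt t u = t" using \<tau> q foldl_nxt_fst[of t u] by (simp add: prod_eq_iff)
qed (use nxt_states start_states in auto)

section \<open>Limit behaviour of the extended runs\<close>

abbreviation aux :: "'a oword \<Rightarrow> nat \<Rightarrow> nat \<times> nat list \<times> nat list" where
  "aux x n \<equiv> srun nxt start x n"

abbreviation pos :: "'a oword \<Rightarrow> nat \<Rightarrow> nat list" where
  "pos x n \<equiv> fst (snd (aux x n))"

abbreviation rec :: "'a oword \<Rightarrow> nat \<Rightarrow> nat list" where
  "rec x n \<equiv> snd (snd (aux x n))"

lemma aux_states: "aux x n \<in> states"
  by (rule srun_closed[OF aut_nxt start_states])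

lemma finite_states: "finite states"
  using aut_nxt by (simp add: aut_def)

lemma aux_fst: "fst (aux x n) = srun d s0 x n"
  by (induction n) (auto simp: start_def nxt_def Let_def)

lemma aux_inv:
  "pos x n \<in> insert [] F" "srun d s0 x n \<in> P (pos x n)" "set (rec x n) = S" "distinct (rec x n)"
  using aux_states[of x n] aux_fst[of x n] by (auto simp: states_def)

lemma srun_S: "srun d s0 x n \<in> S"
  using aux_inv(2) by (simp add: P_def)

lemma rec_Suc: "rec x (Suc n) = lar (rec x n) (srun d s0 x (Suc n))"
  by (simp add: nxt_def Let_def aux_fst)

lemma pos_mono: "m \<le> n \<Longrightarrow> prefix (pos x m) (pos x n)"
proof (induction n rule: dec_induct)
  case (step n)
  have "prefix (pos x n) (pos x (Suc n))"
    using nxt_states(2)[OF aux_states] by simp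
  with step.IH show ?case by (rule prefix_order.trans)
qed simp

text \<open>The nodes ascend in a finite forest. The limit is not the artificial root, since no word
  stays in \<open>P []\<close>.\<close>

lemma pos_limit: "\<exists>\<tau>\<in>F. \<exists>n. \<forall>m\<ge>n. pos x m = \<tau>"
proof -
  have "\<forall>n. True \<longrightarrow> length (pos x n) < Suc (Max (length ` insert [] F))"
    using finite_F aux_inv(1) by (auto simp: less_Suc_eq_le intro!: Max_ge)
  then obtain n where n: "\<And>m. length (pos x m) \<le> length (pos x n)"
    using ex_has_greatest_nat[of "\<lambda>_. True" 0 "\<lambda>n. length (pos x n)"] by blast
  have const: "pos x m = pos x n" if "m \<ge> n" for m
    using pos_mono[OF that, of x] n[of m] by (auto simp: prefix_def)
  let ?x = "\<lambda>i. x (n + i)" and ?\<tau> = "pos x n"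
  have "srun d s0 x (n + j) \<in> P ?\<tau>" for j
    using aux_inv(2)[of x "n + j"] const[of "n + j"] by simp
  then have "?x \<in> stay d (P ?\<tau>) (srun d s0 x n)"
    by (simp add: stay_def flip: srun_shift)
  then have "?\<tau> \<in> F"
    using stay_P[OF aux_inv(1) aux_inv(2), of x n] by (metis empty_iff)
  then show ?thesis using const by blast
qed

section \<open>The family built from the extended automaton\<close>

definition U1 :: "nat list \<Rightarrow> 'a oword set" where
  "U1 \<tau> = {x. \<exists>n. prefix \<tau> (pos x n)}"

lemma tilde_U1:
  assumes "\<tau> \<in> F" "x \<in> tilde F U1 \<tau>"
  shows "\<exists>n. \<forall>m\<ge>n. pos x m = \<tau>"
proof -
  obtain n where n: "prefix \<tau> (pos x n)" using assms(2) by (auto simp: tilde_def U1_def)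
  have "pos x m = \<tau>" if "m \<ge> n" for m
  proof (rule ccontr)
    assume "pos x m \<noteq> \<tau>"
    moreover have "prefix \<tau> (pos x m)" using n pos_mono[OF that] by (rule prefix_order.trans)
    ultimately obtain i where i: "prefix (\<tau> @ [i]) (pos x m)" using prefix_snoc by metis
    then have "pos x m \<in> F" using aux_inv(1)[of x m] by auto
    then have "\<tau> @ [i] \<in> F" using i by (rule F_prefix) simp
    moreover have "x \<in> U1 (\<tau> @ [i])" unfolding U1_def using i by blast
    ultimately show False using assms(2) by (auto simp: tilde_def)
  qed
  then show ?thesis by blast
qed

text \<open>Since nodes only ascend, reaching \<open>\<tau>\<close> once means being above it from
  then on. The first form gives openness, the second a Muller condition.\<close>

lemma U1_lang: "U1 \<tau> \<in> langs ap \<inter> Sigma01"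
proof
  have "(\<exists>n. prefix \<tau> (pos x n)) \<longleftrightarrow> (\<exists>n. \<forall>m\<ge>n. prefix \<tau> (pos x m))" for x
    using prefix_order.trans[OF _ pos_mono] by (meson order_refl)
  then have "U1 \<tau> = {x. infs nxt start x \<in> {E. \<forall>t\<in>E. prefix \<tau> (fst (snd t))}}"
    using eventually_infs[OF finite_states aux_states, of "\<lambda>t. prefix \<tau> (fst (snd t))"]
    by (simp add: U1_def)
  then show "U1 \<tau> \<in> langs ap" by (rule ssubst) (rule langsI[OF aut_nxt])
  have "cantor_open {x. \<exists>n. prefix \<tau> (pos x n)}"
  proof (rule cantor_open_prefixes)
    fix x y :: "'a oword" and n
    assume "\<And>i. i < n \<Longrightarrow> x i = y i" "prefix \<tau> (pos x n)"
    then show "prefix \<tau> (pos y n)" using srun_cong[of n x y nxt start] by simp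
  qed
  then show "U1 \<tau> \<in> Sigma01" by (simp add: Sigma01_def U1_def)
qed

text \<open>If \<open>set s = S\<close>, the prefix \<open>s\<close> of the record may stay unchanged although its last state is visited
  for ever; hence the condition \<open>S - set s \<noteq> {}\<close>.\<close>

definition B :: "(nat list \<Rightarrow> nat list) \<Rightarrow> nat list \<Rightarrow> 'a oword set" where
  "B H \<sigma> = {x. \<exists>s n. prefix \<sigma> (H s) \<and> S - set s \<noteq> {} \<and> (\<forall>m\<ge>n. prefix s (rec x m))}"

text \<open>Stability of a prefix of the record is a condition on the infinity set, and for a fixed
  prefix and starting time it is closed; there are countably many such pairs.\<close>

lemma B_lang: "B H \<sigma> \<in> langs ap \<inter> Sigma02"
proof
  have "(\<exists>n. \<forall>m\<ge>n. prefix s (rec x m)) \<longleftrightarrow> (\<forall>t\<in>infs nxt start x. prefix s (snd (snd t)))" for s x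
    by (rule eventually_infs[OF finite_states aux_states])
  then have "B H \<sigma> = {x. infs nxt start x \<in> {E. \<exists>s. prefix \<sigma> (H s) \<and> S - set s \<noteq> {} \<and>
      (\<forall>t\<in>E. prefix s (snd (snd t)))}}" by (simp add: B_def)
  then show "B H \<sigma> \<in> langs ap" by (rule ssubst) (rule langsI[OF aut_nxt])
  define C where "C = (\<lambda>(s, n::nat). if prefix \<sigma> (H s) \<and> S - set s \<noteq> {}
    then {x. \<forall>m. n \<le> m \<longrightarrow> prefix s (rec x m)} else {})"
  have "cantor_closed (C sn)" for sn
  proof -
    obtain s n where sn: "sn = (s, n)" by (cases sn)
    have "cantor_closed {x. \<forall>m. n \<le> m \<longrightarrow> prefix s (rec x m)}"
    proof (rule cantor_closed_prefixes)
      fix x y :: "'a oword" and m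
      assume "\<And>i. i < m \<Longrightarrow> x i = y i" "n \<le> m \<longrightarrow> prefix s (rec x m)"
      then show "n \<le> m \<longrightarrow> prefix s (rec y m)" using srun_cong[of m x y nxt start] by simp
    qed
    moreover have "cantor_closed ({} :: 'a oword set)"
      by (simp add: cantor_closed_def cantor_open_def)
    ultimately show ?thesis by (simp add: C_def sn)
  qed
  then have "(\<Union>sn. C sn) \<in> Sigma02" by (rule Sigma02_UN_countable)
  moreover have "x \<in> B H \<sigma> \<longleftrightarrow> (\<exists>s n. x \<in> C (s, n))" for x
    unfolding B_def C_def by (simp del: Diff_eq_empty_iff) metis
  then have "B H \<sigma> = (\<Union>sn. C sn)" by auto
  ultimately show "B H \<sigma> \<in> Sigma02" by simp
qed

text \<open>For a word in the component of \<open>\<tau>\<close> and \<open>\<sigma>\<close>, the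
  stable prefix \<open>s\<close> listing exactly the states outside the infinity set is the longest
  one that counts in \<open>B\<close>. Hence \<open>\<sigma>\<close> is the node chosen for
  \<open>s\<close>, whose label is correct by the choice of \<open>H\<close>.\<close>

lemma regular_family:
  "\<exists>U U2. is_F_family (langs ap \<inter> Sigma01) (langs ap \<inter> Sigma02) F c U U2 \<and> determines F c U2 (A s0)"
proof -
  let ?V = "\<lambda>\<tau>. fst (c \<tau>)" and ?v = "\<lambda>\<tau>. snd (c \<tau>)"
  have "\<exists>H. (\<forall>s. H s \<in> ?V \<tau>) \<and> (\<forall>s s'. prefix s s' \<longrightarrow> prefix (H s) (H s')) \<and>
    (\<forall>s. loop d (S - set s) \<longrightarrow> S - set s \<subseteq> P \<tau> \<longrightarrow> ?v \<tau> (H s) = g (S - set s))" if \<tau>: "\<tau> \<in> F" for \<tau>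
  proof (rule history_choice)
    show "P \<tau> \<subseteq> S" by (auto simp: P_def)
    show "det2 (?V \<tau>) (?v \<tau>) [] (stay d (P \<tau>) q) (A q)" if "q \<in> P \<tau>" for q
      using stay_P[OF _ that] \<tau> by simp
  qed (use \<tau> finite_V Nil_V in auto)
  then obtain H where H: "\<And>\<tau> s. \<tau> \<in> F \<Longrightarrow> H \<tau> s \<in> ?V \<tau>"
    "\<And>\<tau> s s'. \<tau> \<in> F \<Longrightarrow> prefix s s' \<Longrightarrow> prefix (H \<tau> s) (H \<tau> s')"
    "\<And>\<tau> s. \<tau> \<in> F \<Longrightarrow> loop d (S - set s) \<Longrightarrow> S - set s \<subseteq> P \<tau> \<Longrightarrow> ?v \<tau> (H \<tau> s) = g (S - set s)"
    by metis
  define U2 where "U2 \<tau> \<sigma> = tilde F U1 \<tau> \<inter> B (H \<tau>) \<sigma>" for \<tau> \<sigma>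
  have "is_family F (langs ap \<inter> Sigma01) UNIV U1"
    unfolding is_family_def
  proof (intro conjI allI impI ballI)
    show "U1 (\<tau> @ [i]) \<subseteq> U1 \<tau>" for \<tau> i
      by (auto simp: U1_def prefix_def)
    have "\<exists>\<tau>\<in>F. x \<in> U1 \<tau>" for x
      using pos_limit[of x] unfolding U1_def by blast
    then show "(\<Union>\<tau>\<in>F. U1 \<tau>) = UNIV" by blast
  qed (rule U1_lang)
  moreover have "is_family (?V \<tau>) {tilde F U1 \<tau> \<inter> C |C. C \<in> langs ap \<inter> Sigma02} (tilde F U1 \<tau>) (U2 \<tau>)"
    if \<tau>: "\<tau> \<in> F" for \<tau>
    unfolding is_family_def
  proof (intro conjI allI impI ballI)
    show "U2 \<tau> \<sigma> \<in> {tilde F U1 \<tau> \<inter> C |C. C \<in> langs ap \<inter> Sigma02}" for \<sigma>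
      using B_lang unfolding U2_def by blast
    show "U2 \<tau> (\<sigma> @ [i]) \<subseteq> U2 \<tau> \<sigma>" for \<sigma> i
      by (auto simp: U2_def B_def dest: append_prefixD)
    \<comment> \<open>The empty prefix of the record is always stable, and \<open>S\<close> is
      nonempty.\<close>
    have "x \<in> B (H \<tau>) []" for x
      unfolding B_def using S(2) by (auto intro!: exI[of _ "[]"])
    then show "(\<Union>\<sigma>\<in>?V \<tau>. U2 \<tau> \<sigma>) = tilde F U1 \<tau>"
      using Nil_V[OF \<tau>] by (auto simp: U2_def)
  qed
  moreover have "A s0 x = ?v \<tau> \<sigma>"
    if \<tau>: "\<tau> \<in> F" and \<sigma>: "\<sigma> \<in> ?V \<tau>" and x: "x \<in> tilde (?V \<tau>) (U2 \<tau>) \<sigma>" for \<tau> \<sigma> x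
  proof -
    let ?E = "infs d s0 x"
    have x1: "x \<in> tilde F U1 \<tau>" "x \<in> B (H \<tau>) \<sigma>" using x by (auto simp: tilde_def U2_def)
    obtain n where n: "\<forall>m\<ge>n. pos x m = \<tau>" using tilde_U1[OF \<tau> x1(1)] by blast
    have EP: "?E \<subseteq> P \<tau>"
    proof
      fix p assume "p \<in> ?E"
      then obtain m where "m \<ge> n" "srun d s0 x m = p" by (metis infs_iff)
      then show "p \<in> P \<tau>" using n aux_inv(2)[of x m] by simp
    qed
    have loop: "loop d ?E" by (rule loop_infs[OF S(1) srun_S])
    have ES: "?E \<subseteq> S" using EP by (auto simp: P_def)
    obtain s n' where s: "set s = S - ?E" "\<And>m. m \<ge> n' \<Longrightarrow> prefix s (rec x m)"
      using lar_limit[of S d s0 x "rec x", OF S(1) srun_S rec_Suc aux_inv(3)] by blast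
    then have s': "S - set s = ?E" using ES by blast
    obtain s1 n1 where s1: "prefix \<sigma> (H \<tau> s1)" "S - set s1 \<noteq> {}" "\<And>m. m \<ge> n1 \<Longrightarrow> prefix s1 (rec x m)"
      using x1(2) unfolding B_def by blast
    have disj: "set s1 \<inter> ?E = {}"
      by (rule lar_stable_prefix[of "rec x" d s0 x S n1, OF rec_Suc aux_inv(3,4) s1(3,2)])
    have p: "prefix s (rec x (max n' n1))" "prefix s1 (rec x (max n' n1))" using s(2) s1(3) by auto
    \<comment> \<open>Otherwise \<open>s1\<close> properly extends \<open>s\<close>, and any further
      entry lies in \<open>?E\<close>, which \<open>s1\<close> avoids.\<close>
    have "prefix s1 s"
    proof (rule ccontr)
      assume not: "\<not> prefix s1 s"
      then obtain r where r: "s1 = s @ r" using prefix_same_cases[OF p] by (auto simp: prefix_def)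
      then obtain e where e: "e \<in> set r" using not by (cases r) auto
      obtain r' where "rec x (max n' n1) = s @ r @ r'" using p(2) r by (auto simp: prefix_def)
      then have "e \<in> S" "e \<notin> set s" using e aux_inv(3,4)[of x "max n' n1"] by auto
      then show False using s' disj e r by auto
    qed
    then have \<sigma>H: "prefix \<sigma> (H \<tau> s)" using s1(1) H(2)[OF \<tau>] prefix_order.trans by blast
    \<comment> \<open>Otherwise the path to \<open>H \<tau> s\<close> passes through a child of
      \<open>\<sigma>\<close>, and \<open>s\<close> puts \<open>x\<close> into the set of that
      child.\<close>
    have "H \<tau> s = \<sigma>"
    proof (rule ccontr)
      assume "H \<tau> s \<noteq> \<sigma>"
      then obtain i where pre: "prefix (\<sigma> @ [i]) (H \<tau> s)" using \<sigma>H prefix_snoc by metis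
      then have "\<sigma> @ [i] \<in> ?V \<tau>" using V_prefix[OF \<tau> H(1)[OF \<tau>]] by blast
      moreover have "?E \<noteq> {}" using loop by (simp add: loop_def)
      then have "x \<in> B (H \<tau>) (\<sigma> @ [i])" unfolding B_def using pre s(2) s' by blast
      then have "x \<in> U2 \<tau> (\<sigma> @ [i])" using x1(1) by (simp add: U2_def)
      ultimately show False using x by (auto simp: tilde_def)
    qed
    then show ?thesis using H(3)[OF \<tau>, of s] s' loop EP by simp
  qed
  ultimately show ?thesis
    by (intro exI[of _ U1] exI[of _ U2]) (auto simp: is_F_family_def determines_def)
qed

end

subsection \<open>Levels of the fine hierarchy\<close>

text \<open>A longest node whose set contains \<open>x\<close> has \<open>x\<close> in its
  component.\<close>

lemma tilde_cover:
  assumes W: "finite W" "is_family W L S U" and x: "x \<in> S"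
  shows "\<exists>\<tau>\<in>W. x \<in> tilde W U \<tau>"
proof -
  define Q where "Q \<tau> \<longleftrightarrow> \<tau> \<in> W \<and> x \<in> U \<tau>" for \<tau>
  obtain \<tau>0 where "Q \<tau>0" using assms by (auto simp: Q_def is_family_def)
  moreover have "\<forall>\<tau>. Q \<tau> \<longrightarrow> length \<tau> < Suc (Max (length ` W))"
    using W by (auto simp: Q_def less_Suc_eq_le)
  ultimately obtain \<tau> where \<tau>: "Q \<tau>" "\<And>\<rho>. Q \<rho> \<Longrightarrow> length \<rho> \<le> length \<tau>"
    using ex_has_greatest_nat[of Q \<tau>0 length "Suc (Max (length ` W))"] by blast
  then have "\<not> Q (\<tau> @ [i])" for i by fastforce
  then show ?thesis using \<tau>(1) by (auto simp: Q_def tilde_def)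
qed

lemma is_family_mono: "is_family W L S U \<Longrightarrow> L \<subseteq> L' \<Longrightarrow> is_family W L' S U"
  by (auto simp: is_family_def)

lemma level_mono:
  assumes "L0 \<subseteq> L0'" "L1 \<subseteq> L1'"
  shows "level k L0 L1 F c \<subseteq> level k L0' L1' F c"
proof -
  have "{T \<inter> B |B. B \<in> L1} \<subseteq> {T \<inter> B |B. B \<in> L1'}" for T
    using assms(2) by blast
  note mono = is_family_mono[OF _ assms(1)] is_family_mono[OF _ this]
  have "is_F_family L0' L1' F c U U2" if "is_F_family L0 L1 F c U U2" for U U2
    using that mono unfolding is_F_family_def by blast
  then show ?thesis by (auto simp: level_def)
qed

text \<open>The component of a word, and hence its value, depends only on membership in finitely
  many sets of the class, so Boolean closure applies.\<close>

lemma level_Bk: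
  assumes F: "is_Tk_forest k F c" and A: "A \<in> level k (langs ap \<inter> L0) (langs ap \<inter> L1) F c"
  shows "A \<in> Bk k (langs ap)"
proof -
  obtain U U2 where k: "\<And>x. A x < k" and fam: "is_F_family (langs ap \<inter> L0) (langs ap \<inter> L1) F c U U2"
    and det: "determines F c U2 A"
    using A unfolding level_def by blast
  have U: "is_family F (langs ap \<inter> L0) UNIV U" and
    U2: "\<And>\<tau>. \<tau> \<in> F \<Longrightarrow> is_family (fst (c \<tau>)) {tilde F U \<tau> \<inter> B | B. B \<in> langs ap \<inter> L1} (tilde F U \<tau>) (U2 \<tau>)"
    using fam by (auto simp: is_F_family_def)
  have fin: "finite F" "\<And>\<tau>. \<tau> \<in> F \<Longrightarrow> finite (fst (c \<tau>))"
    using F by (auto simp: is_Tk_forest_def is_forest_def is_ktree_def Let_def)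
  have "\<exists>B. B \<in> langs ap \<and> U2 \<tau> \<sigma> = tilde F U \<tau> \<inter> B" if "\<tau> \<in> F" "\<sigma> \<in> fst (c \<tau>)" for \<tau> \<sigma>
    using U2[OF that(1)] that(2) unfolding is_family_def by blast
  then obtain B where B: "\<And>\<tau> \<sigma>. \<tau> \<in> F \<Longrightarrow> \<sigma> \<in> fst (c \<tau>) \<Longrightarrow> B \<tau> \<sigma> \<in> langs ap"
    "\<And>\<tau> \<sigma>. \<tau> \<in> F \<Longrightarrow> \<sigma> \<in> fst (c \<tau>) \<Longrightarrow> U2 \<tau> \<sigma> = tilde F U \<tau> \<inter> B \<tau> \<sigma>"
    by metis
  let ?L = "U ` F \<union> (\<Union>\<tau>\<in>F. B \<tau> ` fst (c \<tau>))"
  have "A -` {i} \<in> langs ap" for i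
  proof (rule langs_Boolean[of ?L])
    show "finite ?L" using fin by auto
    show "?L \<subseteq> langs ap" using U B(1) by (auto simp: is_family_def)
    fix x y assume eq: "\<And>L. L \<in> ?L \<Longrightarrow> x \<in> L \<longleftrightarrow> y \<in> L" and x: "x \<in> A -` {i}"
    obtain \<tau> where \<tau>: "\<tau> \<in> F" "x \<in> tilde F U \<tau>" using tilde_cover[OF fin(1) U] by blast
    obtain \<sigma> where \<sigma>: "\<sigma> \<in> fst (c \<tau>)" "x \<in> tilde (fst (c \<tau>)) (U2 \<tau>) \<sigma>"
      using tilde_cover[OF fin(2) U2 \<tau>(2)] \<tau>(1) by blast
    have "x \<in> U \<rho> \<longleftrightarrow> y \<in> U \<rho>" if "\<rho> \<in> F" for \<rho> using eq that by blast
    then have y: "y \<in> tilde F U \<tau>" using \<tau> by (auto simp: tilde_def)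
    have "x \<in> B \<tau> \<rho> \<longleftrightarrow> y \<in> B \<tau> \<rho>" if "\<rho> \<in> fst (c \<tau>)" for \<rho> using eq \<tau>(1) that by blast
    then have "y \<in> tilde (fst (c \<tau>)) (U2 \<tau>) \<sigma>"
      using \<sigma> \<tau> y B(2) by (auto simp: tilde_def)
    then have "A x = A y" using det \<tau>(1) \<sigma> unfolding determines_def by metis
    then show "y \<in> A -` {i}" using x by simp
  qed
  then show ?thesis using k by (simp add: Bk_def)
qed

text \<open>Below the forest a root with the whole space is added; its component is empty because
  the roots of the forest already cover everything. On the second level the relative sets are
  replaced by ambient ones.\<close>

lemma level_det1:
  assumes F: "is_Tk_forest k F c" and A: "A \<in> level k Sigma01 Sigma02 F c"
  shows "det1 F c [] A"
proof -
  obtain U U2 where fam: "is_F_family Sigma01 Sigma02 F c U U2" and det: "determines F c U2 A"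
    using A unfolding level_def by blast
  have U: "is_family F Sigma01 UNIV U" and
    U2: "\<And>\<tau>. \<tau> \<in> F \<Longrightarrow> is_family (fst (c \<tau>)) {tilde F U \<tau> \<inter> B | B. B \<in> Sigma02} (tilde F U \<tau>) (U2 \<tau>)"
    using fam by (auto simp: is_F_family_def)
  have V: "[] \<in> fst (c \<tau>)" "\<And>\<sigma> i. \<sigma> @ [i] \<in> fst (c \<tau>) \<Longrightarrow> \<sigma> \<in> fst (c \<tau>)" if "\<tau> \<in> F" for \<tau>
    using F that by (auto simp: is_Tk_forest_def is_ktree_def Let_def)
  have F': "[] \<notin> F" "\<And>\<rho> i. \<rho> @ [i] \<in> F \<Longrightarrow> \<rho> \<noteq> [] \<Longrightarrow> \<rho> \<in> F"
    using F by (auto simp: is_Tk_forest_def is_forest_def)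
  \<comment> \<open>Outside the forest \<open>U\<close> is unconstrained, so the empty set is used
    to have open sets everywhere.\<close>
  define W where "W \<rho> = (if \<rho> = [] then UNIV else if \<rho> \<in> F then U \<rho> else {})" for \<rho>
  have root: "\<exists>i. [i] \<in> F \<and> x \<in> U [i]" if "\<tau> \<in> F" "x \<in> U \<tau>" for x \<tau>
    using that
  proof (induction \<tau> rule: rev_induct)
    case (snoc i \<tau>)
    show ?case
    proof (cases "\<tau> = []")
      case False
      then have "\<tau> \<in> F" "x \<in> U \<tau>" using snoc.prems F'(2) U unfolding is_family_def by blast+
      then show ?thesis by (rule snoc.IH)
    qed (use snoc.prems in auto)
  qed (use F' in simp)
  have cover: "\<exists>i. [i] \<in> F \<and> x \<in> U [i]" for x
  proof -
    have "x \<in> (\<Union>\<tau>\<in>F. U \<tau>)" using U by (simp add: is_family_def)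
    then show ?thesis using root by blast
  qed
  show ?thesis unfolding det1_def
  proof (intro exI[of _ W] conjI allI ballI impI)
    show "cantor_open (W \<rho>)" for \<rho>
      using U by (auto simp: W_def is_family_def Sigma01_def cantor_open_def)
    show "W [] = UNIV" by (simp add: W_def)
    fix \<rho> assume "\<rho> \<in> insert [] F"
    then consider "\<rho> = []" | "\<rho> \<in> F" by blast
    then show "tilde F W \<rho> = {} \<or> \<rho> \<in> F \<and> det2 (fst (c \<rho>)) (snd (c \<rho>)) [] (tilde F W \<rho>) A"
    proof cases
      case 1
      have "tilde F W [] = {}" using cover by (force simp: tilde_def W_def)
      then show ?thesis using 1 by simp
    next
      case \<rho>: 2
      then have tilde: "tilde F W \<rho> = tilde F U \<rho>"
        using F'(1) by (auto simp: tilde_def W_def)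
      have "\<exists>B. B \<in> Sigma02 \<and> U2 \<rho> \<sigma> = tilde F U \<rho> \<inter> B" if "\<sigma> \<in> fst (c \<rho>)" for \<sigma>
        using U2[OF \<rho>] that unfolding is_family_def by blast
      then obtain B where B: "\<And>\<sigma>. \<sigma> \<in> fst (c \<rho>) \<Longrightarrow> B \<sigma> \<in> Sigma02"
        "\<And>\<sigma>. \<sigma> \<in> fst (c \<rho>) \<Longrightarrow> U2 \<rho> \<sigma> = tilde F U \<rho> \<inter> B \<sigma>"
        by metis
      have sub: "U2 \<rho> \<sigma> \<subseteq> U2 \<rho> []" if "\<sigma> \<in> fst (c \<rho>)" for \<sigma>
        using that
      proof (induction \<sigma> rule: rev_induct)
        case (snoc i \<sigma>)
        then have "\<sigma> \<in> fst (c \<rho>)" using V(2)[OF \<rho>] by blast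
        then show ?case using snoc U2[OF \<rho>] unfolding is_family_def by blast
      qed simp
      have "(\<Union>\<sigma>\<in>fst (c \<rho>). U2 \<rho> \<sigma>) = tilde F U \<rho>" using U2[OF \<rho>] by (simp add: is_family_def)
      then have "tilde F U \<rho> \<subseteq> B []" using sub B(2)[OF V(1)[OF \<rho>]] by blast
      moreover have "A x = snd (c \<rho>) \<sigma>"
        if "\<sigma> \<in> fst (c \<rho>)" "x \<in> tilde F U \<rho> \<inter> tilde (fst (c \<rho>)) B \<sigma>" for x \<sigma>
      proof -
        have "x \<in> tilde (fst (c \<rho>)) (U2 \<rho>) \<sigma>" using that B(2) by (auto simp: tilde_def)
        then show ?thesis using det \<rho> that(1) by (auto simp: determines_def)
      qed
      ultimately have "det2 (fst (c \<rho>)) (snd (c \<rho>)) [] (tilde F U \<rho>) A"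
        unfolding det2_def using V(1)[OF \<rho>] B(1) by blast
      then show ?thesis using \<rho> tilde by simp
    qed
  qed
qed

lemma Bk_level:
  assumes F: "is_Tk_forest k F c" and A: "A \<in> Bk k (langs ap)" "A \<in> level k Sigma01 Sigma02 F c"
  shows "A \<in> level k (langs ap \<inter> Sigma01) (langs ap \<inter> Sigma02) F c"
proof -
  let ?L = "(\<lambda>i. A -` {i}) ` {..<k}"
  have k: "A x < k" for x using A(1) by (simp add: Bk_def)
  have "finite ?L" "?L \<subseteq> langs ap" using A(1) by (auto simp: Bk_def)
  then obtain S s0 and d :: "nat \<Rightarrow> 'a \<Rightarrow> nat" where aut: "aut ap S s0 d" and
    sep: "\<forall>L\<in>?L. \<forall>x y. infs d s0 x = infs d s0 y \<longrightarrow> x \<in> L \<longrightarrow> y \<in> L"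
    using common_automaton[of ?L ap] by blast
  have eq: "A x = A y" if "infs d s0 x = infs d s0 y" for x y
  proof -
    have "A -` {A x} \<in> ?L" using k[of x] by blast
    from sep[rule_format, OF this that] show ?thesis by simp
  qed
  \<comment> \<open>By \<open>eq\<close> the choice of the representative word does not matter; on
    sets that are no infinity set the value is arbitrary.\<close>
  define g where "g E = A (SOME x. infs d s0 x = E)" for E
  have "infs d s0 (SOME y. infs d s0 y = infs d s0 x) = infs d s0 x" for x
    by (rule someI[of "\<lambda>y. infs d s0 y = infs d s0 x" x]) (rule refl)
  then have "A x = g (infs d s0 x)" for x
    unfolding g_def by (intro eq) (rule sym)
  then have g: "A = (\<lambda>x. g (infs d s0 x))" by blast
  interpret determined_aut ap S s0 d g k F c
    using aut F level_det1[OF F A(2)] g by unfold_locales auto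
  show ?thesis using regular_family k g unfolding level_def by auto
qed

theorem theorem4p14:
  fixes \<B> :: "('a::finite) oword set set"
    and k :: nat and F :: "nat list set" and c :: "nat list \<Rightarrow> nat list set \<times> (nat list \<Rightarrow> nat)"
  assumes "card (UNIV :: 'a set) \<ge> 2"
    and "k \<ge> 2"
    and "\<B> = regular_langs \<or> \<B> = aperiodic_langs"
    and "is_Tk_forest k F c"
  shows "level k (\<B> \<inter> Sigma01) (\<B> \<inter> Sigma02) F c = Bk k \<B> \<inter> level k Sigma01 Sigma02 F c"
proof -
  obtain ap where ap: "\<B> = langs ap" using assms(3) by (metis langs_def)
  show ?thesis unfolding ap
  proof (intro equalityI subsetI IntI)
    fix A assume A: "A \<in> level k (langs ap \<inter> Sigma01) (langs ap \<inter> Sigma02) F c"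
    show "A \<in> Bk k (langs ap)" by (rule level_Bk[OF assms(4) A])
    show "A \<in> level k Sigma01 Sigma02 F c"
      using A level_mono[of "langs ap \<inter> Sigma01" Sigma01 "langs ap \<inter> Sigma02" Sigma02] by blast
  qed (use Bk_level[OF assms(4)] in blast)
qed

end
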